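(* Let $G$ be the subgroup of $\mathrm{SL}(\mathrm{J}_3(\mathbb{O}))\cong\mathrm{SL}_{27}$ generated by $\mathrm{Spin}_7(\mathbb{C})$ and $\mathrm{SL}_3(\mathbb{C})$. The action of $\mathbb{C}^*\times G$ on $\mathrm{J}_3(\mathbb{O})$ (with $\mathbb{C}^*$ acting by scaling) is prehomogeneous, i.e. it has a Zariski-dense open orbit.
   Context: $\mathbb{O}$ denotes the complexified octonions with conjugation $z\mapsto\overline z$ and $|z|^2=z\overline z\in\mathbb{C}$. $\mathrm{J}_3(\mathbb{O})$ is the 27-dimensional complex vector space of Hermitian matrices $$A=\begin{pmatrix}\lambda_1 & c & \overline b\\ \overline c & \lambda_2 & a\\ b & \overline a & \lambda_3\end{pmatrix},\quad a,b,c\in\mathbb{O},\ \lambda_i\in\mathbb{C}.$$ Group actions on $\mathrm{J}_3(\mathbb{O})$: $C\in\mathrm{SL}_3$ acts by $C.A={}^{t}C\,A\,C$. With $\mathrm{SO}_8=\mathrm{SO}(\mathbb{O},|\cdot|^2)$, put $$\mathrm{Spin}_7=\{(T_1,T_2,T_1)\in(\mathrm{SO}_8)^3:\ T_1(x)T_2(y)=T_1(xy)\ \text{for all }x,y\in\mathbb{O}\},$$ and $\mathrm{K}_T(x)=\overline{T(\overline x)}$ for $T\in\mathrm{SO}_8$. Then $(T_1,T_2,T_1)\in\mathrm{Spin}_7$ acts by $$(T_1,T_2,T_1).A=\begin{pmatrix}\lambda_1 & T_2(c) & \overline{\mathrm{K}_{T_1}(b)}\\ \overline{T_2(c)} & \lambda_2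 & T_1(a)\\ \mathrm{K}_{T_1}(b) & \overline{T_1(a)} & \lambda_3\end{pmatrix}.$$ *)

theory Defs
  imports "HOL-Analysis.Analysis" "HOL-Algebra.Group_Action" "HOL-Algebra.Generated_Groups"
begin

section \<open>Complexified octonions\<close>

text \<open>
  The index type \<open>8\<close> has the elements \<open>0, \<dots>, 7\<close>; \<open>e\<^sub>0\<close> is the unit.  The imaginary units
  multiply by \<open>e\<^sub>i e\<^sub>i = - 1\<close> and \<open>e\<^sub>i e\<^sub>i\<^sub>+\<^sub>1 = e\<^sub>i\<^sub>+\<^sub>3\<close> (indices modulo 7 in \<open>1, \<dots>, 7\<close>), where each
  triple \<open>(i, i+1, i+3)\<close> may be permuted cyclically and distinct imaginary units anticommute.
\<close>

type_synonym octo = "complex^8"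

definition octo_mult :: "octo \<Rightarrow> octo \<Rightarrow> octo" (infixl "\<odot>" 70) where
  "x \<odot> y =
    (let w = (\<lambda>i j. x $ i * y $ j - x $ j * y $ i) in
     \<chi> k. if k = 0 then x$0 * y$0 - (\<Sum>i\<in>UNIV - {0}. x$i * y$i)
          else x$0 * y$k + x$k * y$0 +
            (if k = 1 then w 2 4 + w 3 7 + w 5 6
             else if k = 2 then w 3 5 + w 4 1 + w 6 7
             else if k = 3 then w 4 6 + w 5 2 + w 7 1
             else if k = 4 then w 5 7 + w 6 3 + w 1 2
             else if k = 5 then w 6 1 + w 7 4 + w 2 3
             else if k = 6 then w 7 2 + w 1 5 + w 3 4
             else w 1 3 + w 2 6 + w 4 5))"

definition octo_of_complex :: "complex \<Rightarrow> octo" where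
  "octo_of_complex t = axis 0 t"

definition octo_cnj :: "octo \<Rightarrow> octo" where
  "octo_cnj z = (\<chi> k. if k = 0 then z $ 0 else - z $ k)"

text \<open>Conjugation is complex linear, and \<open>z \<odot> octo_cnj z\<close> is a multiple of the unit.\<close>

definition octo_normsq :: "octo \<Rightarrow> complex" where
  "octo_normsq z = (z \<odot> octo_cnj z) $ 0"

lemma UNIV_8: "(UNIV :: 8 set) = {0, 1, 2, 3, 4, 5, 6, 7}"
proof -
  have "card {0, 1, 2, 3, 4, 5, 6, 7 :: 8} = CARD(8)" by simp
  thus ?thesis by (metis card_subset_eq finite subset_UNIV)
qed

lemma UNIV_8_nonzero: "UNIV - {0 :: 8} = {1, 2, 3, 4, 5, 6, 7}"
  unfolding UNIV_8 by (simp add: insert_Diff_if)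

lemma forall_8: "(\<forall>k :: 8. P k) \<longleftrightarrow> P 0 \<and> P 1 \<and> P 2 \<and> P 3 \<and> P 4 \<and> P 5 \<and> P 6 \<and> P 7"
  by (simp only: ball_UNIV[symmetric] UNIV_8 ball_simps simp_thms)

lemma neq_8:
  "(1 :: 8) \<noteq> 0" "(2 :: 8) \<noteq> 0" "(2 :: 8) \<noteq> 1" "(3 :: 8) \<noteq> 0" "(3 :: 8) \<noteq> 1" "(3 :: 8) \<noteq> 2" "(4 :: 8) \<noteq> 0" "(4 :: 8) \<noteq> 1" "(4 :: 8) \<noteq> 2" "(4 :: 8) \<noteq> 3" "(5 :: 8) \<noteq> 0" "(5 :: 8) \<noteq> 1" "(5 :: 8) \<noteq> 2" "(5 :: 8) \<noteq> 3" "(5 :: 8) \<noteq> 4" "(6 :: 8) \<noteq> 0" "(6 :: 8) \<noteq> 1" "(6 :: 8) \<noteq> 2" "(6 :: 8) \<noteq> 3" "(6 :: 8) \<noteq> 4" "(6 :: 8) \<noteq> 5" "(7 :: 8) \<noteq> 0" "(7 :: 8) \<noteq> 1" "(7 :: 8) \<noteq> 2" "(7 :: 8) \<noteq> 3" "(7 :: 8) \<noteq> 4" "(7 :: 8) \<noteq> 5" "(7 :: 8) \<noteq> 6"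
  by simp_all

lemma sum_8_nonzero:
  "(\<Sum>k\<in>UNIV - {0 :: 8}. f k) = f 1 + f 2 + f 3 + f 4 + f 5 + f 6 + (f 7 :: 'a :: comm_monoid_add)"
  unfolding UNIV_8_nonzero by (simp add: add.assoc)

lemma octo_mult_nth:
  "(x \<odot> y) $ 0 = x$0*y$0 - (x$1*y$1 + x$2*y$2 + x$3*y$3 + x$4*y$4 + x$5*y$5 + x$6*y$6 + x$7*y$7)"
  "(x \<odot> y) $ 1 = x$0*y$1 + x$1*y$0 + ((x$2*y$4 - x$4*y$2) + (x$3*y$7 - x$7*y$3) + (x$5*y$6 - x$6*y$5))"
  "(x \<odot> y) $ 2 = x$0*y$2 + x$2*y$0 + ((x$3*y$5 - x$5*y$3) + (x$4*y$1 - x$1*y$4) + (x$6*y$7 - x$7*y$6))"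
  "(x \<odot> y) $ 3 = x$0*y$3 + x$3*y$0 + ((x$4*y$6 - x$6*y$4) + (x$5*y$2 - x$2*y$5) + (x$7*y$1 - x$1*y$7))"
  "(x \<odot> y) $ 4 = x$0*y$4 + x$4*y$0 + ((x$5*y$7 - x$7*y$5) + (x$6*y$3 - x$3*y$6) + (x$1*y$2 - x$2*y$1))"
  "(x \<odot> y) $ 5 = x$0*y$5 + x$5*y$0 + ((x$6*y$1 - x$1*y$6) + (x$7*y$4 - x$4*y$7) + (x$2*y$3 - x$3*y$2))"
  "(x \<odot> y) $ 6 = x$0*y$6 + x$6*y$0 + ((x$7*y$2 - x$2*y$7) + (x$1*y$5 - x$5*y$1) + (x$3*y$4 - x$4*y$3))"
  "(x \<odot> y) $ 7 = x$0*y$7 + x$7*y$0 + ((x$1*y$3 - x$3*y$1) + (x$2*y$6 - x$6*y$2) + (x$4*y$5 - x$5*y$4))"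
  by (simp_all only: octo_mult_def Let_def vec_lambda_beta sum_8_nonzero neq_8 if_True if_False refl)

lemma octo_of_complex_nth:
  "octo_of_complex t $ k = (if k = 0 then t else 0)"
  by (simp add: octo_of_complex_def axis_def)

lemma octo_cnj_nth:
  "octo_cnj z $ k = (if k = 0 then z $ 0 else - z $ k)"
  by (simp add: octo_cnj_def)

lemma octo_mult_one [simp]:
  "octo_of_complex 1 \<odot> x = x" "x \<odot> octo_of_complex 1 = x"
  unfolding vec_eq_iff forall_8 octo_mult_nth octo_of_complex_nth by simp_all

lemma octo_mult_cnj: "z \<odot> octo_cnj z = octo_of_complex (octo_normsq z)"
  unfolding vec_eq_iff forall_8 octo_normsq_def octo_mult_nth octo_of_complex_nth octo_cnj_nth
  by (simp add: mult.commute)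

lemma octo_normsq_eq:
  "octo_normsq z = (z$0)\<^sup>2 + (z$1)\<^sup>2 + (z$2)\<^sup>2 + (z$3)\<^sup>2 + (z$4)\<^sup>2 + (z$5)\<^sup>2 + (z$6)\<^sup>2 + (z$7)\<^sup>2"
  unfolding octo_normsq_def octo_mult_nth octo_cnj_nth
  by (simp add: power2_eq_square)

lemma octo_normsq_mult: "octo_normsq (x \<odot> y) = octo_normsq x * octo_normsq y"
  unfolding octo_normsq_eq octo_mult_nth by algebra


section \<open>The space of Hermitian matrices\<close>

definition hmat ::
  "complex \<Rightarrow> complex \<Rightarrow> complex \<Rightarrow> octo \<Rightarrow> octo \<Rightarrow> octo \<Rightarrow> octo^3^3" where
  "hmat l1 l2 l3 a b c =
    vector [vector [octo_of_complex l1, c, octo_cnj b],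
            vector [octo_cnj c, octo_of_complex l2, a],
            vector [b, octo_cnj a, octo_of_complex l3]]"

definition J3 :: "(octo^3^3) set" where
  "J3 = {hmat l1 l2 l3 a b c | l1 l2 l3 a b c. True}"

definition j3_scale :: "complex \<Rightarrow> octo^3^3 \<Rightarrow> octo^3^3" where
  "j3_scale t A = (\<chi> i j. t *s A $ i $ j)"

text \<open>
  Linear coordinates on \<^term>\<open>J3\<close>: the scalars \<open>\<lambda>\<^sub>i\<close> and the components of
  \<open>c = A $ 1 $ 2\<close>, \<open>a = A $ 2 $ 3\<close>, \<open>b = A $ 3 $ 1\<close>; note that \<open>3 + 1 = 1\<close> in the type \<open>3\<close>.
\<close>

type_synonym j3_index = "3 + 3 \<times> 8"

definition j3_coords :: "octo^3^3 \<Rightarrow> complex^j3_index" where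
  "j3_coords A = (\<chi> k. case k of Inl i \<Rightarrow> A $ i $ i $ 0 | Inr (i, m) \<Rightarrow> A $ i $ (i + 1) $ m)"

lemma octo_cnj_cnj [simp]: "octo_cnj (octo_cnj z) = z"
  by (simp add: octo_cnj_def vec_eq_iff)

lemma octo_cnj_of_complex [simp]: "octo_cnj (octo_of_complex t) = octo_of_complex t"
  by (simp add: octo_cnj_def octo_of_complex_def axis_def vec_eq_iff)

lemma octo_cnj_fixed: "octo_cnj z = z \<longleftrightarrow> z = octo_of_complex (z $ 0)"
  by (auto simp: octo_cnj_def octo_of_complex_def axis_def vec_eq_iff forall_8)

lemma J3_iff_hermitian: "A \<in> J3 \<longleftrightarrow> (\<forall>i j. A $ j $ i = octo_cnj (A $ i $ j))"
proof
  assume "A \<in> J3"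
  thus "\<forall>i j. A $ j $ i = octo_cnj (A $ i $ j)"
    by (auto simp: J3_def hmat_def forall_3)
next
  assume H: "\<forall>i j. A $ j $ i = octo_cnj (A $ i $ j)"
  have d: "A $ i $ i = octo_of_complex (A $ i $ i $ 0)" for i
    using H octo_cnj_fixed by metis
  have "\<forall>i j. A $ i $ j = hmat (A$1$1$0) (A$2$2$0) (A$3$3$0) (A$2$3) (A$3$1) (A$1$2) $ i $ j"
    unfolding forall_3 hmat_def vector_3
    by (intro conjI; (rule d | rule H[rule_format] | rule refl))
  hence "A = hmat (A$1$1$0) (A$2$2$0) (A$3$3$0) (A$2$3) (A$3$1) (A$1$2)"
    unfolding vec_eq_iff by blast
  thus "A \<in> J3" unfolding J3_def by blast
qed

lemma succ_3: "(1 :: 3) + 1 = 2" "(2 :: 3) + 1 = 3" "(3 :: 3) + 1 = 1" "(4 :: 3) = 1"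
  by simp_all

lemma bij_betw_j3_coords: "bij_betw j3_coords J3 UNIV"
proof (rule bij_betwI')
  fix A B assume "A \<in> J3" "B \<in> J3"
  then obtain l1 l2 l3 a b c m1 m2 m3 a' b' c' where
    AB: "A = hmat l1 l2 l3 a b c" "B = hmat m1 m2 m3 a' b' c'"
    unfolding J3_def by blast
  show "j3_coords A = j3_coords B \<longleftrightarrow> A = B"
  proof
    assume eq: "j3_coords A = j3_coords B"
    have 1: "A $ i $ i $ 0 = B $ i $ i $ 0" for i
      using arg_cong[OF eq, of "\<lambda>v. v $ Inl i"] by (simp add: j3_coords_def)
    have 2: "A $ i $ (i + 1) = B $ i $ (i + 1)" for i
      using arg_cong[OF eq, of "\<lambda>v. v $ Inr (i, _)"] by (simp add: j3_coords_def vec_eq_iff)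
    show "A = B"
      using 1[of 1] 1[of 2] 1[of 3] 2[of 1, unfolded succ_3] 2[of 2, unfolded succ_3] 2[of 3, unfolded succ_3]
      by (simp add: AB hmat_def octo_of_complex_def axis_def)
  qed simp
next
  fix v :: "complex^j3_index"
  define o' where "o' i = (\<chi> m. v $ Inr (i, m))" for i
  have "v = j3_coords (hmat (v $ Inl 1) (v $ Inl 2) (v $ Inl 3) (o' 2) (o' 3) (o' 1))"
    unfolding vec_eq_iff
  proof
    fix k show "v $ k = j3_coords (hmat (v $ Inl 1) (v $ Inl 2) (v $ Inl 3) (o' 2) (o' 3) (o' 1)) $ k"
    proof (cases k)
      case (Inl i)
      thus ?thesis using exhaust_3[of i]
        by (auto simp: j3_coords_def hmat_def octo_of_complex_def axis_def)
    next
      case (Inr p)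
      obtain i m where "p = (i, m)" by force
      with Inr show ?thesis using exhaust_3[of i]
        by (auto simp: j3_coords_def hmat_def o'_def succ_3)
    qed
  qed
  thus "\<exists>A\<in>J3. v = j3_coords A" unfolding J3_def by blast
qed auto


section \<open>The groups and their actions\<close>

text \<open>
  An element of \<open>SL(J\<^sub>3)\<close> is a bijection of \<^term>\<open>J3\<close> that in the linear coordinates is multiplication
  by a matrix of determinant 1.
\<close>

definition SL_J3 :: "(octo^3^3 \<Rightarrow> octo^3^3) monoid" where
  "SL_J3 = BijGroup J3 \<lparr>carrier :=
     {f \<in> Bij J3. \<exists>M :: complex^j3_index^j3_index.
        det M = 1 \<and> (\<forall>A\<in>J3. j3_coords (f A) = M *v j3_coords A)}\<rparr>"

definition SL3 :: "(complex^3^3) set" where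
  "SL3 = {C. det C = 1}"

text \<open>Entry \<open>(i, j)\<close> of \<open>\<^sup>tC A C\<close>.\<close>

definition sl3_act :: "complex^3^3 \<Rightarrow> octo^3^3 \<Rightarrow> octo^3^3" where
  "sl3_act C A = (\<chi> i j. \<Sum>k\<in>UNIV. \<Sum>l\<in>UNIV. (C $ k $ i * C $ l $ j) *s A $ k $ l)"

definition SO8 :: "(octo \<Rightarrow> octo) set" where
  "SO8 = {T. Vector_Spaces.linear (*s) (*s) T \<and> (\<forall>x. octo_normsq (T x) = octo_normsq x) \<and>
             det (matrix T) = 1}"

definition Spin7 :: "((octo \<Rightarrow> octo) \<times> (octo \<Rightarrow> octo) \<times> (octo \<Rightarrow> octo)) set" where
  "Spin7 = {(T1, T2, T1) | T1 T2. T1 \<in> SO8 \<and> T2 \<in> SO8 \<and> (\<forall>x y. T1 x \<odot> T2 y = T1 (x \<odot> y))}"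

definition K_conj :: "(octo \<Rightarrow> octo) \<Rightarrow> octo \<Rightarrow> octo" where
  "K_conj T x = octo_cnj (T (octo_cnj x))"

fun spin7_act :: "(octo \<Rightarrow> octo) \<times> (octo \<Rightarrow> octo) \<times> (octo \<Rightarrow> octo) \<Rightarrow> octo^3^3 \<Rightarrow> octo^3^3" where
  "spin7_act (T1, T2, T3) A =
    (let a = A $ 2 $ 3; b = A $ 3 $ 1; c = A $ 1 $ 2 in
     hmat (A $ 1 $ 1 $ 0) (A $ 2 $ 2 $ 0) (A $ 3 $ 3 $ 0) (T1 a) (K_conj T3 b) (T2 c))"

definition G_J3 :: "(octo^3^3 \<Rightarrow> octo^3^3) monoid" where
  "G_J3 = SL_J3 \<lparr>carrier :=
     generate SL_J3 ({\<lambda>A\<in>J3. spin7_act T A | T. T \<in> Spin7} \<union> {\<lambda>A\<in>J3. sl3_act C A | C. C \<in> SL3})\<rparr>"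

definition Cstar :: "complex monoid" where
  "Cstar = \<lparr>carrier = - {0}, mult = (*), one = 1\<rparr>"

definition scaling_act ::
  "complex \<times> (octo^3^3 \<Rightarrow> octo^3^3) \<Rightarrow> octo^3^3 \<Rightarrow> octo^3^3" where
  "scaling_act = (\<lambda>(t, g). \<lambda>A\<in>J3. j3_scale t (g A))"

lemma group_SL_J3: "group SL_J3"
proof -
  interpret B: group "BijGroup J3" by (rule group_BijGroup)
  let ?P = "\<lambda>f M. \<forall>A\<in>J3. j3_coords (f A) = M *v j3_coords A"
  let ?H = "{f \<in> Bij J3. \<exists>M :: complex^j3_index^j3_index. det M = 1 \<and> ?P f M}"
  have "subgroup ?H (BijGroup J3)"
  proof (rule B.subgroupI)
    show "?H \<subseteq> carrier (BijGroup J3)" by (auto simp: BijGroup_def)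
    have "(\<lambda>A\<in>J3. A) \<in> ?H" by (auto simp: id_Bij intro!: exI[of _ "mat 1"])
    thus "?H \<noteq> {}" by blast
  next
    fix f assume f: "f \<in> ?H"
    then obtain M :: "complex^j3_index^j3_index" where M: "det M = 1" "?P f M" by blast
    from M(1) obtain N where N: "N ** M = mat 1" "M ** N = mat 1"
      using invertible_det_nz[of M] unfolding invertible_def by auto
    have dN: "det N = 1"
      using det_mul[of N M] N M(1) by simp
    have inv: "inv\<^bsub>BijGroup J3\<^esub> f = (\<lambda>A\<in>J3. inv_into J3 f A)"
      using f by (simp add: inv_BijGroup)
    have bij: "bij_betw f J3 J3" using f by (simp add: Bij_def)
    have "?P (\<lambda>A\<in>J3. inv_into J3 f A) N"
    proof
      fix A assume A: "A \<in> J3"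
      have B: "inv_into J3 f A \<in> J3" "f (inv_into J3 f A) = A"
        using bij A by (auto simp: bij_betw_def inv_into_into f_inv_into_f)
      hence "j3_coords A = M *v j3_coords (inv_into J3 f A)" using M(2) by metis
      thus "j3_coords ((\<lambda>A\<in>J3. inv_into J3 f A) A) = N *v j3_coords A"
        using A by (simp add: matrix_vector_mul_assoc N)
    qed
    thus "inv\<^bsub>BijGroup J3\<^esub> f \<in> ?H"
      using f dN by (auto simp: inv intro!: restrict_inv_into_Bij)
  next
    fix f g assume fg: "f \<in> ?H" "g \<in> ?H"
    then obtain M N :: "complex^j3_index^j3_index"
      where MN: "det M = 1" "?P f M" "det N = 1" "?P g N" by blast
    have g: "g A \<in> J3" if "A \<in> J3" for A
      using fg that by (auto simp: Bij_def bij_betw_def)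
    have "?P (compose J3 f g) (M ** N)"
      using MN g by (auto simp: compose_def matrix_vector_mul_assoc)
    moreover have "det (M ** N) = 1" using MN by (simp add: det_mul)
    moreover have "f \<otimes>\<^bsub>BijGroup J3\<^esub> g = compose J3 f g" "compose J3 f g \<in> Bij J3"
      using fg by (auto simp: BijGroup_def compose_Bij)
    ultimately show "f \<otimes>\<^bsub>BijGroup J3\<^esub> g \<in> ?H" by auto
  qed
  from B.subgroup_imp_group[OF this] show ?thesis unfolding SL_J3_def .
qed


section \<open>The Zariski topology\<close>

inductive polynomial_fun :: "(complex^'n \<Rightarrow> complex) \<Rightarrow> bool" where
  const: "polynomial_fun (\<lambda>v. t)"
| coord: "polynomial_fun (\<lambda>v. v $ i)"
| add: "polynomial_fun p \<Longrightarrow> polynomial_fun q \<Longrightarrow> polynomial_fun (\<lambda>v. p v + q v)"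
| mult: "polynomial_fun p \<Longrightarrow> polynomial_fun q \<Longrightarrow> polynomial_fun (\<lambda>v. p v * q v)"

definition zariski :: "(complex^'n) topology" where
  "zariski = topology (\<lambda>U. \<exists>P. (\<forall>p\<in>P. polynomial_fun p) \<and> - U = {v. \<forall>p\<in>P. p v = 0})"

definition zariski_J3 :: "(octo^3^3) topology" where
  "zariski_J3 = pullback_topology J3 j3_coords zariski"

lemma openin_zariski:
  fixes U :: "(complex^'n) set"
  shows "openin zariski U \<longleftrightarrow> (\<exists>P. (\<forall>p\<in>P. polynomial_fun p) \<and> - U = {v. \<forall>p\<in>P. p v = 0})"
proof -
  let ?O = "\<lambda>U :: (complex^'n) set. \<exists>P. (\<forall>p\<in>P. polynomial_fun p) \<and> - U = {v. \<forall>p\<in>P. p v = 0}"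
  have "istopology ?O"
    unfolding istopology_def
  proof (intro conjI allI impI)
    fix S T :: "(complex^'n) set" assume "?O S" "?O T"
    then obtain P Q where P: "\<forall>p\<in>P. polynomial_fun p" "- S = {v. \<forall>p\<in>P. p v = 0}"
      and Q: "\<forall>p\<in>Q. polynomial_fun p" "- T = {v. \<forall>p\<in>Q. p v = 0}" by blast
    define R where "R = {\<lambda>v. p v * q v | p q. p \<in> P \<and> q \<in> Q}"
    have "\<forall>p\<in>R. polynomial_fun p" using P(1) Q(1) by (auto simp: R_def intro: polynomial_fun.mult)
    moreover have "- (S \<inter> T) = {v. \<forall>p\<in>R. p v = 0}"
    proof -
      have "- (S \<inter> T) = - S \<union> - T" by blast
      also have "\<dots> = {v. \<forall>p\<in>R. p v = 0}" unfolding P(2) Q(2) R_def by fastforce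
      finally show ?thesis .
    qed
    ultimately show "?O (S \<inter> T)" by blast
  next
    fix K :: "(complex^'n) set set" assume "\<forall>S\<in>K. ?O S"
    from bchoice[OF this] obtain F where F:
      "\<forall>S\<in>K. (\<forall>p\<in>F S. polynomial_fun p) \<and> - S = {v. \<forall>p\<in>F S. p v = 0}" by blast
    have "- \<Union>K = {v. \<forall>p\<in>(\<Union>S\<in>K. F S). p v = 0}"
    proof -
      have "- \<Union>K = (\<Inter>S\<in>K. - S)" by blast
      also have "\<dots> = (\<Inter>S\<in>K. {v. \<forall>p\<in>F S. p v = 0})" using F by (intro INF_cong) auto
      also have "\<dots> = {v. \<forall>p\<in>(\<Union>S\<in>K. F S). p v = 0}" by blast
      finally show ?thesis .
    qed
    moreover have "\<forall>p\<in>(\<Union>S\<in>K. F S). polynomial_fun p" using F by blast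
    ultimately show "?O (\<Union>K)" by blast
  qed
  thus ?thesis by (simp add: zariski_def topology_inverse')
qed

lemma topspace_zariski: "topspace zariski = UNIV"
proof -
  have "openin zariski UNIV"
    unfolding openin_zariski by (rule exI[of _ "{\<lambda>v. 1}"]) (simp add: polynomial_fun.const)
  thus ?thesis using openin_subset by blast
qed

lemma topspace_zariski_J3: "topspace zariski_J3 = J3"
  by (simp add: zariski_J3_def topspace_pullback_topology topspace_zariski)

end

theory Submission
  imports Defs
begin

text \<open>
  Every element of the group acts on \<^term>\<open>J3\<close> by an invertible linear map, hence by a
  homeomorphism of the Zariski topology. So an orbit that contains one nonempty principal open set
  \<open>{p \<noteq> 0}\<close> is open, being a union of translates of that set, and it is dense, because two nonzero
  polynomial functions always have a common non-root (restrict both to a line). It therefore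
  suffices to bring a generic matrix to the identity matrix, with explicit polynomial conditions
  \<open>p \<noteq> 0\<close> for what generic means (\<open>generic_poly\<close>).

  The reduction is Gaussian elimination (\<open>G_moves_eliminate\<close>, \<open>G_moves_generic\<close>).
  Transvections in \<open>SL\<^sub>3\<close> have complex coefficients, so that adding a multiple of the third row and
  column to the first can remove the entry \<open>b\<close> only if \<open>b\<close> is a scalar. But \<open>Spin\<^sub>7\<close> moves every
  octonion \<open>x\<close> with \<open>|x|\<^sup>2 = t\<^sup>2 \<noteq> 0\<close> to the scalar \<open>t\<close> (\<open>Spin7_to_scalar\<close>), and then one transvection
  removes it. Permutation matrices bring each of the three octonion entries in turn to this place,
  so a generic matrix becomes diagonal, and a diagonal matrix in \<open>SL\<^sub>3\<close> together with a
  scaling makes it the identity. During the elimination the square norms of the remaining entries are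
  rational functions of the original entries: the only one that is not immediate is \<open>|c|\<^sup>2\<close>
  after the removal of \<open>b\<close>, which is computed from the relation \<open>T\<^sub>1(a) T\<^sub>2(c) = T\<^sub>1(a c)\<close>.

  To compute in the generated group, in particular with its inverses, the generators must be
  elements of \<^term>\<open>SL_J3\<close>, that is, they must have determinant 1 on the space of dimension 27. For
  \<open>Spin\<^sub>7\<close> the matrix consists of blocks, each of determinant 1. For \<open>SL\<^sub>3\<close> the determinant of the
  action is a multiplicative function of the matrix; a transvection is conjugate to its own square,
  so this function takes the value 1 on it, and Gaussian elimination leaves only the diagonal
  matrices (\<open>det_sl3_matrix\<close>).
\<close>

section \<open>Polynomial functions and the Zariski topology\<close>

lemma polynomial_fun_line:
  fixes u w :: "complex^'n"
  assumes "polynomial_fun p"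
  shows "\<exists>P :: complex poly. \<forall>s. p (u + s *s w) = poly P s"
  using assms
proof induction
  case (const t)
  show ?case by (rule exI[of _ "[:t:]"]) simp
next
  case (coord i)
  show ?case by (rule exI[of _ "[:u $ i, w $ i:]"]) simp
next
  case (add p q)
  then obtain P Q where "\<forall>s. p (u + s *s w) = poly P s" "\<forall>s. q (u + s *s w) = poly Q s" by blast
  thus ?case by (intro exI[of _ "P + Q"]) simp
next
  case (mult p q)
  then obtain P Q where "\<forall>s. p (u + s *s w) = poly P s" "\<forall>s. q (u + s *s w) = poly Q s" by blast
  thus ?case by (intro exI[of _ "P * Q"]) simp
qed

text \<open>
  The line through \<open>u\<close> and \<open>v\<close> meets each zero set in finitely many points, since \<open>p\<close> does not
  vanish at \<open>u\<close> and \<open>q\<close> does not vanish at \<open>v\<close>.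
\<close>

lemma polynomial_fun_common_nonzero:
  fixes u v :: "complex^'n"
  assumes p: "polynomial_fun p" "p u \<noteq> 0" and q: "polynomial_fun q" "q v \<noteq> 0"
  shows "\<exists>x. p x \<noteq> 0 \<and> q x \<noteq> 0"
proof -
  obtain P Q where P: "\<And>s. p (u + s *s (v - u)) = poly P s" and Q: "\<And>s. q (u + s *s (v - u)) = poly Q s"
    using polynomial_fun_line[OF p(1), of u "v - u"] polynomial_fun_line[OF q(1), of u "v - u"] by blast
  have "poly P 0 \<noteq> 0" "poly Q 1 \<noteq> 0"
    using p(2) q(2) P[of 0] Q[of 1] by simp_all
  hence "P * Q \<noteq> 0" by auto
  hence "finite {s. poly (P * Q) s = 0}" by (rule poly_roots_finite)
  then obtain s where "poly (P * Q) s \<noteq> 0"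
    using ex_new_if_finite[OF infinite_UNIV_char_0] by blast
  hence "p (u + s *s (v - u)) \<noteq> 0 \<and> q (u + s *s (v - u)) \<noteq> 0" unfolding P Q by simp
  thus ?thesis by blast
qed

lemma polynomial_fun_sum:
  assumes "\<And>i. i \<in> I \<Longrightarrow> polynomial_fun (f i)"
  shows "polynomial_fun (\<lambda>v. \<Sum>i\<in>I. f i v)"
  using assms
  by (induction I rule: infinite_finite_induct) (auto intro: polynomial_fun.intros)

lemma polynomial_fun_linear_subst:
  fixes M :: "complex^'m^'n"
  assumes "polynomial_fun p"
  shows "polynomial_fun (\<lambda>v. p (M *v v))"
  using assms
proof induction
  case (coord i)
  show ?case unfolding matrix_vector_mult_def
    by (simp, intro polynomial_fun_sum polynomial_fun.intros)
qed (auto intro: polynomial_fun.intros)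

lemma polynomial_fun_diff:
  assumes "polynomial_fun p" "polynomial_fun q"
  shows "polynomial_fun (\<lambda>v. p v - q v)"
  using polynomial_fun.add[OF assms(1) polynomial_fun.mult[OF polynomial_fun.const[of "-1"] assms(2)]]
  by simp

lemma polynomial_fun_power:
  assumes "polynomial_fun p"
  shows "polynomial_fun (\<lambda>v. p v ^ n)"
  by (induction n) (auto intro: polynomial_fun.intros assms)

lemma openin_zariski_J3_nonzero:
  assumes "polynomial_fun p"
  shows "openin zariski_J3 {A \<in> J3. p (j3_coords A) \<noteq> 0}"
proof -
  have "openin zariski {v. p v \<noteq> 0}"
    unfolding openin_zariski using assms by (intro exI[of _ "{p}"]) auto
  moreover have "{A \<in> J3. p (j3_coords A) \<noteq> 0} = j3_coords -` {v. p v \<noteq> 0} \<inter> J3" by auto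
  ultimately show ?thesis
    unfolding zariski_J3_def openin_pullback_topology by blast
qed

lemma openin_zariski_J3_basic:
  assumes "openin zariski_J3 V" "A \<in> V"
  obtains q where "polynomial_fun q" "q (j3_coords A) \<noteq> 0"
    "{B \<in> J3. q (j3_coords B) \<noteq> 0} \<subseteq> V"
proof -
  obtain U where U: "openin zariski U" "V = j3_coords -` U \<inter> J3"
    using assms(1) unfolding zariski_J3_def openin_pullback_topology by blast
  obtain P where P: "\<forall>p\<in>P. polynomial_fun p" "- U = {v. \<forall>p\<in>P. p v = 0}"
    using U(1) unfolding openin_zariski by blast
  have "j3_coords A \<notin> - U" using assms(2) U(2) by blast
  then obtain q where q: "q \<in> P" "q (j3_coords A) \<noteq> 0" unfolding P(2) by blast
  have "v \<in> U" if "q v \<noteq> 0" for v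
  proof (rule ccontr)
    assume "v \<notin> U"
    hence "v \<in> - U" by blast
    thus False using that q(1) unfolding P(2) by blast
  qed
  hence "{B \<in> J3. q (j3_coords B) \<noteq> 0} \<subseteq> V" unfolding U(2) by blast
  thus ?thesis using that q P(1) by blast
qed

lemma zariski_J3_dense:
  assumes "polynomial_fun p" "p u \<noteq> 0" "{A \<in> J3. p (j3_coords A) \<noteq> 0} \<subseteq> S"
  shows "zariski_J3 closure_of S = J3"
proof -
  have "\<exists>y\<in>S. y \<in> V" if V: "openin zariski_J3 V" "A \<in> V" for A V
  proof -
    obtain q where q: "polynomial_fun q" "q (j3_coords A) \<noteq> 0" "{B \<in> J3. q (j3_coords B) \<noteq> 0} \<subseteq> V"
      by (rule openin_zariski_J3_basic[OF V])
    obtain x where x: "p x \<noteq> 0" "q x \<noteq> 0"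
      using polynomial_fun_common_nonzero[OF assms(1,2) q(1,2)] by (elim exE conjE)
    have "x \<in> j3_coords ` J3" using bij_betw_j3_coords by (simp add: bij_betw_def)
    then obtain B where B: "B \<in> J3" "x = j3_coords B" by (rule imageE)
    hence "B \<in> S" "B \<in> V"
      using x by (auto intro!: subsetD[OF assms(3)] subsetD[OF q(3)])
    thus ?thesis by (rule bexI[rotated])
  qed
  hence dense: "\<forall>V. A \<in> V \<and> openin zariski_J3 V \<longrightarrow> (\<exists>y\<in>S. y \<in> V)" for A
    by (intro allI impI) (elim conjE)
  show ?thesis
    unfolding closure_of_def topspace_zariski_J3
    using dense by (intro subset_antisym subsetI CollectI conjI) (elim CollectE conjE, assumption)+
qed

section \<open>Isometries of the octonions and elements of Spin(7)\<close>

lemma octo_algebra_linear: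
  "(x + y) \<odot> z = x \<odot> z + y \<odot> z" "z \<odot> (x + y) = z \<odot> x + z \<odot> y"
  "(t *s x) \<odot> z = t *s (x \<odot> z)" "z \<odot> (t *s x) = t *s (z \<odot> x)"
  unfolding vec_eq_iff forall_8 octo_mult_nth vector_add_component vector_smult_component
  by (simp_all add: algebra_simps)

lemma octo_left_alternative: "u \<odot> (u \<odot> x) = (u \<odot> u) \<odot> x"
  unfolding vec_eq_iff forall_8 octo_mult_nth by (intro conjI; algebra)

lemma octo_right_alternative: "(x \<odot> u) \<odot> u = x \<odot> (u \<odot> u)"
  unfolding vec_eq_iff forall_8 octo_mult_nth by (intro conjI; algebra)

text \<open>
  With \<open>u\<close> an imaginary unit, this identity says that right multiplication by \<open>u\<close> belongs
  to \<open>Spin\<^sub>7\<close>.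
\<close>

lemma octo_right_Moufang: "((z \<odot> u) \<odot> y) \<odot> u = z \<odot> ((u \<odot> y) \<odot> u)"
  unfolding vec_eq_iff forall_8 octo_mult_nth by (intro conjI; algebra)

lemma octo_mult_scalar: "x \<odot> octo_of_complex t = t *s x" "octo_of_complex t \<odot> x = t *s x"
  unfolding vec_eq_iff forall_8 octo_mult_nth octo_of_complex_nth vector_smult_component by simp_all

text \<open>
  The complex bilinear form with quadratic form \<^term>\<open>octo_normsq\<close>; it is not Hermitian.
\<close>

definition octo_inner :: "octo \<Rightarrow> octo \<Rightarrow> complex" where
  "octo_inner x y = (\<Sum>k\<in>UNIV. x $ k * y $ k)"

lemma octo_inner_expand:
  "octo_inner x y = x$0*y$0 + x$1*y$1 + x$2*y$2 + x$3*y$3 + x$4*y$4 + x$5*y$5 + x$6*y$6 + x$7*y$7"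
  unfolding octo_inner_def UNIV_8 by (simp add: add.assoc)

lemma octo_inner_self: "octo_inner x x = octo_normsq x"
  unfolding octo_inner_expand octo_normsq_eq by (simp add: power2_eq_square)

lemma octo_inner_cnj_right: "octo_inner y (octo_cnj x) = (x \<odot> y) $ 0"
  unfolding octo_inner_expand octo_mult_nth octo_cnj_nth by simp

lemma octo_normsq_add: "octo_normsq (x + y) = octo_normsq x + 2 * octo_inner x y + octo_normsq y"
  unfolding octo_inner_expand octo_normsq_eq vector_add_component
  by (simp add: power2_eq_square algebra_simps)

lemma octo_normsq_scale: "octo_normsq (t *s x) = t\<^sup>2 * octo_normsq x"
  unfolding octo_normsq_eq vector_smult_component by (simp add: power_mult_distrib algebra_simps)

lemma octo_normsq_cnj [simp]: "octo_normsq (octo_cnj x) = octo_normsq x"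
  unfolding octo_normsq_eq octo_cnj_nth by simp

lemma linear_octoI:
  fixes T :: "octo \<Rightarrow> octo"
  assumes "\<And>x y. T (x + y) = T x + T y" "\<And>t x. T (t *s x) = t *s T x"
  shows "Vector_Spaces.linear (*s) (*s) T"
  using assms by (simp add: Vector_Spaces.linear_iff vec.vector_space_axioms)

lemma linear_octoD:
  fixes T :: "octo \<Rightarrow> octo"
  assumes "Vector_Spaces.linear (*s) (*s) T"
  shows "T (x + y) = T x + T y" "T (t *s x) = t *s T x" "T 0 = 0"
  using assms vec.linear_0 by (auto simp: Vector_Spaces.linear_iff vec.vector_space_axioms)

lemma octo_isometry_inner:
  assumes "Vector_Spaces.linear (*s) (*s) T" "\<And>x. octo_normsq (T x) = octo_normsq x"
  shows "octo_inner (T x) (T y) = octo_inner x y"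
  using octo_normsq_add[of "T x" "T y"] octo_normsq_add[of x y] assms(2)
  by (simp add: linear_octoD(1)[OF assms(1), symmetric])

text \<open>
  The matrix of an isometry is orthogonal, so its determinant is a sign.
\<close>

lemma det_isometry_square:
  assumes "Vector_Spaces.linear (*s) (*s) T" "\<And>x. octo_normsq (T x) = octo_normsq x"
  shows "det (matrix (T \<circ> T)) = 1"
proof -
  let ?M = "matrix T"
  have "(transpose ?M ** ?M) $ i $ j = mat 1 $ i $ j" for i j
  proof -
    have "(transpose ?M ** ?M) $ i $ j = octo_inner (T (axis i 1)) (T (axis j 1))"
      by (simp add: matrix_matrix_mult_def transpose_def matrix_def octo_inner_def)
    also have "\<dots> = octo_inner (axis i 1) (axis j 1)" by (rule octo_isometry_inner[OF assms])
    also have "\<dots> = mat 1 $ i $ j"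
      by (auto simp: octo_inner_def axis_def mat_def if_distrib[of "\<lambda>x. x * _"] cong: if_cong)
    finally show ?thesis .
  qed
  hence "transpose ?M ** ?M = mat 1" by (simp add: vec_eq_iff)
  hence "det ?M * det ?M = 1" by (metis det_I det_mul det_transpose)
  thus ?thesis using matrix_compose_gen[OF assms(1) assms(1)] by (simp add: det_mul)
qed

definition imaginary_unit :: "octo \<Rightarrow> bool" where
  "imaginary_unit u \<longleftrightarrow> u $ 0 = 0 \<and> octo_normsq u = 1"

lemma imaginary_unit_square: "imaginary_unit u \<Longrightarrow> u \<odot> u = octo_of_complex (- 1)"
  unfolding vec_eq_iff forall_8 octo_mult_nth octo_of_complex_nth imaginary_unit_def octo_normsq_eq
  by (elim conjE) (simp add: power2_eq_square algebra_simps)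

text \<open>
  The element \<open>(1 + u) / \<surd>2\<close> is a square root of \<open>u\<close> of norm 1. Multiplication by \<open>u\<close> is thus the square
  of an isometry, and its determinant is 1.
\<close>

lemma imaginary_unit_sqrt:
  assumes "imaginary_unit u"
  obtains g where "octo_normsq g = 1" "g \<odot> g = u"
proof
  define r :: complex where "r = of_real (1 / sqrt 2)"
  have r: "r * r = 1/2" unfolding r_def by (simp flip: of_real_mult add: real_sqrt_mult_self)
  let ?g = "r *s (octo_of_complex 1 + u)"
  have "octo_normsq (octo_of_complex 1 + u) = 2"
    using assms unfolding imaginary_unit_def octo_normsq_eq vector_add_component octo_of_complex_nth
    by (elim conjE) (simp add: add.assoc)
  thus "octo_normsq ?g = 1" unfolding octo_normsq_scale using r by (simp add: power2_eq_square)
  have "(octo_of_complex 1 + u) \<odot> (octo_of_complex 1 + u) = 2 *s u"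
    unfolding octo_algebra_linear octo_mult_one imaginary_unit_square[OF assms]
    by (simp add: vec_eq_iff octo_of_complex_nth)
  moreover have "?g \<odot> ?g = (r * r) *s ((octo_of_complex 1 + u) \<odot> (octo_of_complex 1 + u))"
    by (simp only: octo_algebra_linear(3,4) vector_smult_assoc)
  ultimately have "?g \<odot> ?g = (r * r) *s (2 *s u)" by simp
  thus "?g \<odot> ?g = u" unfolding r by (simp add: vec_eq_iff)
qed

lemma imaginary_unit_mult_SO8:
  assumes "imaginary_unit u"
  shows "(\<lambda>x. x \<odot> u) \<in> SO8" "(\<lambda>x. u \<odot> x) \<in> SO8"
proof -
  obtain g where g: "octo_normsq g = 1" "g \<odot> g = u" using imaginary_unit_sqrt[OF assms] .
  have lin: "Vector_Spaces.linear (*s) (*s) (\<lambda>x. x \<odot> v)" "Vector_Spaces.linear (*s) (*s) (\<lambda>x. v \<odot> x)" for v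
    by (rule linear_octoI; simp add: octo_algebra_linear)+
  have u: "octo_normsq u = 1" using assms by (simp add: imaginary_unit_def)
  have "(\<lambda>x. x \<odot> g) \<circ> (\<lambda>x. x \<odot> g) = (\<lambda>x. x \<odot> u)"
    by (simp add: fun_eq_iff octo_right_alternative g)
  moreover have "det (matrix ((\<lambda>x. x \<odot> g) \<circ> (\<lambda>x. x \<odot> g))) = 1"
    by (rule det_isometry_square[OF lin(1)]) (simp add: octo_normsq_mult g)
  ultimately have "det (matrix (\<lambda>x. x \<odot> u)) = 1" by simp
  thus "(\<lambda>x. x \<odot> u) \<in> SO8" using lin by (simp add: SO8_def octo_normsq_mult u)
  have "(\<lambda>x. g \<odot> x) \<circ> (\<lambda>x. g \<odot> x) = (\<lambda>x. u \<odot> x)"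
    by (simp add: fun_eq_iff octo_left_alternative g)
  moreover have "det (matrix ((\<lambda>x. g \<odot> x) \<circ> (\<lambda>x. g \<odot> x))) = 1"
    by (rule det_isometry_square[OF lin(2)]) (simp add: octo_normsq_mult g)
  ultimately have "det (matrix (\<lambda>x. u \<odot> x)) = 1" by simp
  thus "(\<lambda>x. u \<odot> x) \<in> SO8" using lin by (simp add: SO8_def octo_normsq_mult u)
qed

lemma SO8_compose: "S \<in> SO8 \<Longrightarrow> T \<in> SO8 \<Longrightarrow> S \<circ> T \<in> SO8"
  unfolding SO8_def by (auto simp: matrix_compose_gen det_mul intro: Vector_Spaces.linear_compose)

lemma Spin7_compose:
  "(S1, S2, S1) \<in> Spin7 \<Longrightarrow> (T1, T2, T1) \<in> Spin7 \<Longrightarrow> (S1 \<circ> T1, S2 \<circ> T2, S1 \<circ> T1) \<in> Spin7"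
  unfolding Spin7_def by (auto intro: SO8_compose)

text \<open>
  The companion of right multiplication by \<open>u\<close> is conjugation \<open>y \<mapsto> u y u\<^sup>-\<^sup>1 = - (u y) u\<close>.
\<close>

lemma right_mult_Spin7:
  assumes "imaginary_unit u"
  shows "\<exists>T2. ((\<lambda>x. x \<odot> u), T2, (\<lambda>x. x \<odot> u)) \<in> Spin7"
proof
  let ?T2 = "(\<lambda>y. y \<odot> (- 1 *s u)) \<circ> (\<lambda>y. u \<odot> y)"
  have "imaginary_unit (- 1 *s u)"
    using assms octo_normsq_scale[of "-1" u] by (simp add: imaginary_unit_def)
  hence "?T2 \<in> SO8" using assms by (intro SO8_compose imaginary_unit_mult_SO8)
  moreover have "(x \<odot> u) \<odot> ?T2 y = (x \<odot> y) \<odot> u" for x y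
  proof -
    have "(x \<odot> u) \<odot> ?T2 y = - 1 *s (((x \<odot> u) \<odot> u) \<odot> y) \<odot> u"
      by (simp only: o_apply octo_algebra_linear octo_right_Moufang)
    also have "(x \<odot> u) \<odot> u = - 1 *s x"
      unfolding octo_right_alternative imaginary_unit_square[OF assms] octo_mult_scalar ..
    also have "- 1 *s (- 1 *s x \<odot> y) \<odot> u = (x \<odot> y) \<odot> u"
      unfolding octo_algebra_linear by (simp add: vec_eq_iff)
    finally show ?thesis .
  qed
  ultimately show "((\<lambda>x. x \<odot> u), ?T2, (\<lambda>x. x \<odot> u)) \<in> Spin7"
    using imaginary_unit_mult_SO8(1)[OF assms] unfolding Spin7_def by blast
qed

text \<open>
  For imaginary \<open>u\<close> the condition says that \<open>u\<close> is orthogonal to the imaginary part of \<open>x\<close>. A vector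
  supported on two coordinates \<open>i, j\<close> and orthogonal to \<open>x\<close> is proportional to \<open>(- x\<^sub>j, x\<^sub>i)\<close>, which can
  be normalized unless \<open>x\<^sub>i\<^sup>2 + x\<^sub>j\<^sup>2 = 0\<close>. If that sum vanishes for all
  pairs among \<open>1, 2, 3\<close>, then \<open>x\<^sub>1 = 0\<close>
  and \<open>e\<^sub>1\<close> is orthogonal to \<open>x\<close>.
\<close>

lemma imaginary_unit_orthogonal: "\<exists>u. imaginary_unit u \<and> (x \<odot> u) $ 0 = 0"
proof -
  have key: "\<exists>u. imaginary_unit u \<and> (x \<odot> u) $ 0 = 0"
    if ij: "i \<noteq> 0" "j \<noteq> 0" "i \<noteq> j" and w: "\<alpha>\<^sup>2 + \<beta>\<^sup>2 \<noteq> 0" "x $ i * \<alpha> + x $ j * \<beta> = 0" for i j \<alpha> \<beta>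
  proof -
    define d where "d = csqrt (\<alpha>\<^sup>2 + \<beta>\<^sup>2)"
    have d: "d\<^sup>2 = \<alpha>\<^sup>2 + \<beta>\<^sup>2" "d \<noteq> 0" using w(1) by (auto simp: d_def)
    define u :: octo where "u = axis i (\<alpha> / d) + axis j (\<beta> / d)"
    have u0: "u $ 0 = 0" using ij by (simp add: u_def axis_def)
    have d1: "(\<alpha>\<^sup>2 + \<beta>\<^sup>2) / d\<^sup>2 = 1" using d w(1) by simp
    have "octo_normsq u = (\<alpha> / d)\<^sup>2 + (\<beta> / d)\<^sup>2"
      unfolding octo_inner_self[symmetric] octo_inner_def u_def
      using ij by (simp add: axis_def algebra_simps sum.distrib if_distrib[of "\<lambda>x. x * _"] power2_eq_square cong: if_cong)
    also have "\<dots> = 1" unfolding power_divide add_divide_distrib[symmetric] by (rule d1)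
    finally have "imaginary_unit u" using u0 by (simp add: imaginary_unit_def)
    moreover have "(x \<odot> u) $ 0 = 0"
    proof -
      have "(x \<odot> u) $ 0 = - octo_inner x u"
        using u0 unfolding octo_inner_expand octo_mult_nth by simp
      also have "octo_inner x u = x $ i * (\<alpha> / d) + x $ j * (\<beta> / d)"
        unfolding octo_inner_def u_def
        using ij by (simp add: axis_def algebra_simps sum.distrib if_distrib[of "\<lambda>x. _ * x"] cong: if_cong)
      also have "\<dots> = (x $ i * \<alpha> + x $ j * \<beta>) / d" by (simp add: add_divide_distrib)
      finally show ?thesis using w(2) by simp
    qed
    ultimately show ?thesis by blast
  qed
  consider "(x$1)\<^sup>2 + (x$2)\<^sup>2 \<noteq> 0" | "(x$1)\<^sup>2 + (x$3)\<^sup>2 \<noteq> 0" | "(x$2)\<^sup>2 + (x$3)\<^sup>2 \<noteq> 0" | "x $ 1 = 0"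
  proof -
    have "x $ 1 = 0" if "(x$1)\<^sup>2 + (x$2)\<^sup>2 = 0" "(x$1)\<^sup>2 + (x$3)\<^sup>2 = 0" "(x$2)\<^sup>2 + (x$3)\<^sup>2 = 0"
    proof -
      have "2 * (x$1)\<^sup>2 = 0" using that by algebra
      thus ?thesis by simp
    qed
    thus ?thesis using that by blast
  qed
  thus ?thesis
  proof cases
    case 1 thus ?thesis using key[of 1 2 "- x $ 2" "x $ 1"] by (simp add: neq_8 algebra_simps)
  next
    case 2 thus ?thesis using key[of 1 3 "- x $ 3" "x $ 1"] by (simp add: neq_8 algebra_simps)
  next
    case 3 thus ?thesis using key[of 2 3 "- x $ 3" "x $ 2"] by (simp add: neq_8 algebra_simps)
  next
    case 4 thus ?thesis using key[of 1 2 1 0] by (simp add: neq_8)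
  qed
qed

text \<open>
  Two right multiplications suffice: if \<open>u\<close> is chosen so that \<open>x u\<close> is imaginary, then \<open>x u = - t v\<close>
  with an imaginary unit \<open>v\<close>, and \<open>(x u) v = - t v\<^sup>2 = t\<close>.
\<close>

lemma Spin7_to_scalar:
  assumes x: "octo_normsq x = t\<^sup>2" and t: "t \<noteq> 0"
  shows "\<exists>T1 T2. (T1, T2, T1) \<in> Spin7 \<and> T1 x = octo_of_complex t"
proof -
  obtain u where u: "imaginary_unit u" "(x \<odot> u) $ 0 = 0" using imaginary_unit_orthogonal by blast
  define v where "v = (- 1 / t) *s (x \<odot> u)"
  have "octo_normsq v = (- 1 / t)\<^sup>2 * (t\<^sup>2 * octo_normsq u)"
    unfolding v_def octo_normsq_scale octo_normsq_mult x ..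
  hence v: "imaginary_unit v"
    using u t by (simp add: imaginary_unit_def v_def power_divide)
  have "x \<odot> u = - t *s v" using t by (simp add: v_def vec_eq_iff)
  hence "(x \<odot> u) \<odot> v = - t *s octo_of_complex (- 1)"
    by (simp only: octo_algebra_linear imaginary_unit_square[OF v])
  also have "\<dots> = octo_of_complex t" by (simp add: vec_eq_iff octo_of_complex_nth)
  finally have xuv: "(x \<odot> u) \<odot> v = octo_of_complex t" .
  obtain U V where "((\<lambda>x. x \<odot> u), U, (\<lambda>x. x \<odot> u)) \<in> Spin7" "((\<lambda>x. x \<odot> v), V, (\<lambda>x. x \<odot> v)) \<in> Spin7"
    using right_mult_Spin7 u v by meson
  hence "((\<lambda>x. x \<odot> v) \<circ> (\<lambda>x. x \<odot> u), V \<circ> U, (\<lambda>x. x \<odot> v) \<circ> (\<lambda>x. x \<odot> u)) \<in> Spin7"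
    by (intro Spin7_compose)
  moreover have "((\<lambda>x. x \<odot> v) \<circ> (\<lambda>x. x \<odot> u)) x = octo_of_complex t" using xuv by simp
  ultimately show ?thesis by blast
qed

section \<open>Coordinates on the space of Hermitian matrices\<close>

definition j3_of_coords :: "complex^j3_index \<Rightarrow> octo^3^3" where
  "j3_of_coords v = hmat (v $ Inl 1) (v $ Inl 2) (v $ Inl 3)
     (\<chi> m. v $ Inr (2, m)) (\<chi> m. v $ Inr (3, m)) (\<chi> m. v $ Inr (1, m))"

lemma hmat_nth:
  "hmat l1 l2 l3 a b c $ 1 $ 1 = octo_of_complex l1" "hmat l1 l2 l3 a b c $ 1 $ 2 = c"
  "hmat l1 l2 l3 a b c $ 1 $ 3 = octo_cnj b" "hmat l1 l2 l3 a b c $ 2 $ 1 = octo_cnj c"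
  "hmat l1 l2 l3 a b c $ 2 $ 2 = octo_of_complex l2" "hmat l1 l2 l3 a b c $ 2 $ 3 = a"
  "hmat l1 l2 l3 a b c $ 3 $ 1 = b" "hmat l1 l2 l3 a b c $ 3 $ 2 = octo_cnj a"
  "hmat l1 l2 l3 a b c $ 3 $ 3 = octo_of_complex l3"
  by (simp_all add: hmat_def)

lemma j3_coords_hmat:
  "j3_coords (hmat l1 l2 l3 a b c) $ Inl 1 = l1" "j3_coords (hmat l1 l2 l3 a b c) $ Inl 2 = l2"
  "j3_coords (hmat l1 l2 l3 a b c) $ Inl 3 = l3" "j3_coords (hmat l1 l2 l3 a b c) $ Inr (1, m) = c $ m"
  "j3_coords (hmat l1 l2 l3 a b c) $ Inr (2, m) = a $ m" "j3_coords (hmat l1 l2 l3 a b c) $ Inr (3, m) = b $ m"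
  by (simp_all add: j3_coords_def hmat_nth succ_3 octo_of_complex_nth)

lemma hmat_in_J3 [simp]: "hmat l1 l2 l3 a b c \<in> J3"
  unfolding J3_def by blast

lemma J3_E:
  assumes "A \<in> J3"
  obtains l1 l2 l3 a b c where "A = hmat l1 l2 l3 a b c"
  using assms unfolding J3_def by blast

lemma j3_of_coords_in_J3 [simp]: "j3_of_coords v \<in> J3"
  by (simp add: j3_of_coords_def)

lemma j3_of_coords_coords [simp]: "A \<in> J3 \<Longrightarrow> j3_of_coords (j3_coords A) = A"
  by (erule J3_E) (simp add: j3_of_coords_def j3_coords_hmat)

lemma forall_j3_index: "(\<forall>k :: j3_index. P k) \<longleftrightarrow> (\<forall>i. P (Inl i)) \<and> (\<forall>i m. P (Inr (i, m)))"
  by (metis obj_sumE surj_pair)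

lemma j3_coords_of_coords [simp]: "j3_coords (j3_of_coords v) = v"
  unfolding vec_eq_iff forall_j3_index forall_3 by (simp add: j3_of_coords_def j3_coords_hmat)

lemma j3_coords_inject: "A \<in> J3 \<Longrightarrow> B \<in> J3 \<Longrightarrow> j3_coords A = j3_coords B \<Longrightarrow> A = B"
  by (metis j3_of_coords_coords)

lemma restrict_in_SL_J3:
  assumes "\<And>A. A \<in> J3 \<Longrightarrow> f A \<in> J3"
    and M: "\<And>A. A \<in> J3 \<Longrightarrow> j3_coords (f A) = M *v j3_coords A" "det M = 1"
  shows "(\<lambda>A\<in>J3. f A) \<in> carrier SL_J3"
proof -
  obtain N where N: "M ** N = mat 1" "N ** M = mat 1"
    using M(2) invertible_det_nz[of M] unfolding invertible_def by auto
  have "bij_betw f J3 J3"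
  proof (rule bij_betw_byWitness[where f' = "\<lambda>A. j3_of_coords (N *v j3_coords A)"])
    show "\<forall>A\<in>J3. j3_of_coords (N *v j3_coords (f A)) = A"
      by (simp add: M matrix_vector_mul_assoc N)
    show "\<forall>A\<in>J3. f (j3_of_coords (N *v j3_coords A)) = A"
    proof
      fix A assume A: "A \<in> J3"
      have "j3_coords (f (j3_of_coords (N *v j3_coords A))) = j3_coords A"
        by (simp add: M matrix_vector_mul_assoc N)
      thus "f (j3_of_coords (N *v j3_coords A)) = A" using A assms(1) by (auto intro: j3_coords_inject)
    qed
  qed (use assms(1) in auto)
  hence "(\<lambda>A\<in>J3. f A) \<in> Bij J3" unfolding Bij_def by (simp cong: bij_betw_cong)
  thus ?thesis using M unfolding SL_J3_def by auto
qed

lemma sum_j3_index: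
  "(\<Sum>k\<in>(UNIV :: j3_index set). f k) = (\<Sum>i\<in>UNIV. f (Inl i)) + (\<Sum>i\<in>UNIV. \<Sum>m\<in>UNIV. f (Inr (i, m)))"
  unfolding UNIV_Plus_UNIV[symmetric] by (simp add: sum.Plus sum.cartesian_product flip: UNIV_Times_UNIV)

lemma prod_j3_index:
  "(\<Prod>k\<in>(UNIV :: j3_index set). f k) = (\<Prod>i\<in>UNIV. f (Inl i)) * (\<Prod>i\<in>UNIV. \<Prod>m\<in>UNIV. f (Inr (i, m)))"
  unfolding UNIV_Plus_UNIV[symmetric] by (simp add: prod.Plus prod.cartesian_product flip: UNIV_Times_UNIV)

lemma j3_coords_add: "j3_coords (A + B) = j3_coords A + j3_coords B"
  unfolding vec_eq_iff forall_j3_index by (simp add: j3_coords_def)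

lemma j3_coords_scale: "j3_coords (j3_scale t A) = t *s j3_coords A"
  unfolding vec_eq_iff forall_j3_index by (simp add: j3_coords_def j3_scale_def)

lemma j3_of_coords_add: "j3_of_coords (v + w) = j3_of_coords v + j3_of_coords w"
  unfolding vec_eq_iff[where 'b = 3] forall_3 j3_of_coords_def hmat_nth vector_add_component
  by (simp add: vec_eq_iff octo_of_complex_nth octo_cnj_nth)

lemma j3_of_coords_scale: "j3_of_coords (t *s v) = j3_scale t (j3_of_coords v)"
  unfolding vec_eq_iff[where 'b = 3] forall_3 j3_of_coords_def
  by (simp add: hmat_nth j3_scale_def vec_eq_iff octo_of_complex_nth octo_cnj_nth)

lemma j3_scale_hmat: "j3_scale t (hmat l1 l2 l3 a b c) = hmat (t * l1) (t * l2) (t * l3) (t *s a) (t *s b) (t *s c)"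
  unfolding vec_eq_iff[where 'b = 3] forall_3
  by (simp add: hmat_nth j3_scale_def vec_eq_iff octo_of_complex_nth octo_cnj_nth)

section \<open>Spin(7) acts with determinant one\<close>

text \<open>
  In the Leibniz formula for \<open>A\<close> only the permutations that fix every index outside the range of \<open>f\<close>
  contribute; they correspond to the permutations of the indices of \<open>B\<close> with the same sign.
\<close>

lemma det_block_embedding:
  fixes B :: "'a::comm_ring_1^'m^'m" and f :: "'m \<Rightarrow> 'n::finite"
  assumes f: "inj f" and A: "\<And>i j. A $ f i $ f j = B $ i $ j"
    and off: "\<And>k l. k \<notin> range f \<or> l \<notin> range f \<Longrightarrow> A $ k $ l = (if k = l then 1 else 0)"
  shows "det A = det B"
proof -
  let ?t = "\<lambda>p. of_int (sign p) * (\<Prod>k\<in>UNIV. A $ k $ p k)"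
  let ?P = "{p. p permutes range f}"
  have bij: "bij_betw f UNIV (range f)" using f by (simp add: inj_on_imp_bij_betw)
  have app: "map_permutation UNIV f q (f i) = f (q i)" for q i
    using f by (simp add: map_permutation_apply)
  have "map_permutation UNIV f = (\<lambda>q x. if x \<in> range f then f (q (inv_into UNIV f x)) else x)"
    unfolding map_permutation_def restrict_id_def o_def ..
  hence bijP: "bij_betw (map_permutation UNIV f) {q. q permutes UNIV} ?P"
    using bij_betw_permutations[OF bij] by (simp only:)
  have "det A = sum ?t ?P"
    unfolding det_def
  proof (rule sum.mono_neutral_right)
    show "?P \<subseteq> {p. p permutes UNIV}" using permutes_subset by blast
    show "\<forall>p\<in>{p. p permutes UNIV} - ?P. ?t p = 0"
    proof
      fix p assume p: "p \<in> {p. p permutes UNIV} - ?P"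
      then obtain k where "k \<notin> range f" "p k \<noteq> k"
        unfolding permutes_def by blast
      hence "A $ k $ p k = 0" using off[of k "p k"] by simp
      hence "(\<Prod>k\<in>UNIV. A $ k $ p k) = 0" by (meson UNIV_I finite prod_zero)
      thus "?t p = 0" by simp
    qed
  qed (simp add: finite_permutations)
  also have "\<dots> = (\<Sum>q\<in>{q. q permutes UNIV}. ?t (map_permutation UNIV f q))"
    by (rule sum.reindex_bij_betw[OF bijP, symmetric])
  also have "\<dots> = det B"
    unfolding det_def
  proof (rule sum.cong)
    fix q assume "q \<in> {q. q permutes (UNIV :: 'm set)}"
    hence q: "q permutes (UNIV :: 'm set)" by simp
    have m: "map_permutation UNIV f q permutes range f"
      using map_permutation_permutes[OF bij q] .
    have "(\<Prod>k\<in>UNIV. A $ k $ map_permutation UNIV f q k)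
        = (\<Prod>k\<in>range f. A $ k $ map_permutation UNIV f q k)"
      using m by (intro prod.mono_neutral_right) (auto simp: off permutes_not_in)
    also have "\<dots> = (\<Prod>i\<in>UNIV. B $ i $ q i)"
      by (subst prod.reindex) (use f in \<open>simp_all add: app A\<close>)
    finally show "?t (map_permutation UNIV f q) = of_int (sign q) * (\<Prod>i\<in>UNIV. B $ i $ q i)"
      using sign_map_permutation[of f UNIV q] f q by simp
  qed simp
  finally show ?thesis .
qed

text \<open>
  The action of \<open>B\<close> on the octonion entry number \<open>i\<close>, with all other coordinates fixed.
\<close>

definition octo_block :: "3 \<Rightarrow> complex^8^8 \<Rightarrow> complex^j3_index^j3_index" where
  "octo_block i B = (\<chi> k l. case (k, l) of
     (Inr (j, m), Inr (j', m')) \<Rightarrow> if j = i \<and> j' = i then B $ m $ m' else if k = l then 1 else 0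
   | _ \<Rightarrow> if k = l then 1 else 0)"

lemma octo_block_mult:
  "(octo_block i B *v v) $ Inl k = v $ Inl k"
  "(octo_block i B *v v) $ Inr (j, m) = (if j = i then (B *v (\<chi> m. v $ Inr (i, m))) $ m else v $ Inr (j, m))"
proof -
  show "(octo_block i B *v v) $ Inl k = v $ Inl k"
    by (simp add: matrix_vector_mult_def octo_block_def sum_j3_index if_distrib[of "\<lambda>x. x * _"] cong: if_cong)
  have "(octo_block i B *v v) $ Inr (j, m)
      = (\<Sum>j'\<in>UNIV. \<Sum>m'\<in>UNIV. (if j = i \<and> j' = i then B $ m $ m' else if j = j' \<and> m = m' then 1 else 0) * v $ Inr (j', m'))"
    by (simp only: matrix_vector_mult_def octo_block_def sum_j3_index vec_lambda_beta prod.case sum.case)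
       (simp cong: if_cong)
  also have "\<dots> = (\<Sum>j'\<in>UNIV. if j' = j then
      (\<Sum>m'\<in>UNIV. (if j = i then B $ m $ m' else if m = m' then 1 else 0) * v $ Inr (j, m')) else 0)"
    by (intro sum.cong refl) (auto intro!: sum.cong sum.neutral)
  also have "\<dots> = (\<Sum>m'\<in>UNIV. (if j = i then B $ m $ m' else if m = m' then 1 else 0) * v $ Inr (j, m'))"
    by simp
  also have "\<dots> = (if j = i then (B *v (\<chi> m. v $ Inr (i, m))) $ m else v $ Inr (j, m))"
    by (simp add: matrix_vector_mult_def if_distrib[of "\<lambda>x. x * _"] cong: if_cong)
  finally show "(octo_block i B *v v) $ Inr (j, m)
    = (if j = i then (B *v (\<chi> m. v $ Inr (i, m))) $ m else v $ Inr (j, m))" .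
qed

lemma det_octo_block: "det (octo_block i B) = det B"
proof (rule det_block_embedding[where f = "\<lambda>m. Inr (i, m)"])
  fix k l :: j3_index
  assume "k \<notin> range (\<lambda>m. Inr (i, m)) \<or> l \<notin> range (\<lambda>m. Inr (i, m))"
  thus "octo_block i B $ k $ l = (if k = l then 1 else 0)"
    by (auto simp: octo_block_def split: sum.splits)
qed (auto simp: octo_block_def inj_def)

lemma linear_octo_cnj: "Vector_Spaces.linear (*s) (*s) octo_cnj"
  by (simp add: Vector_Spaces.linear_iff vec.vector_space_axioms vec_eq_iff octo_cnj_nth)

lemma det_K_conj:
  assumes "Vector_Spaces.linear (*s) (*s) T"
  shows "Vector_Spaces.linear (*s) (*s) (K_conj T)" "det (matrix (K_conj T)) = det (matrix T)"
proof -
  have K: "K_conj T = octo_cnj \<circ> (T \<circ> octo_cnj)" by (simp add: K_conj_def fun_eq_iff)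
  note J = linear_octo_cnj
  have TJ: "Vector_Spaces.linear (*s) (*s) (T \<circ> octo_cnj)" using J assms by (rule Vector_Spaces.linear_compose)
  show "Vector_Spaces.linear (*s) (*s) (K_conj T)"
    unfolding K using TJ J by (rule Vector_Spaces.linear_compose)
  have "octo_cnj \<circ> octo_cnj = id" by (simp add: fun_eq_iff)
  hence "matrix octo_cnj ** matrix octo_cnj = mat 1"
    using matrix_compose_gen[OF J J] by (simp add: matrix_id_mat_1)
  hence "det (matrix octo_cnj) * det (matrix octo_cnj) = 1" by (metis det_I det_mul)
  thus "det (matrix (K_conj T)) = det (matrix T)"
    unfolding K by (simp add: matrix_compose_gen[OF TJ J] matrix_compose_gen[OF J assms] det_mul)
qed

lemma spin7_act_hmat:
  "spin7_act (T1, T2, T3) (hmat l1 l2 l3 a b c) = hmat l1 l2 l3 (T1 a) (K_conj T3 b) (T2 c)"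
  by (simp add: hmat_nth octo_of_complex_nth)

lemma spin7_act_in_SL_J3:
  assumes "T \<in> Spin7"
  shows "(\<lambda>A\<in>J3. spin7_act T A) \<in> carrier SL_J3"
proof -
  obtain T1 T2 where T: "T = (T1, T2, T1)" "T1 \<in> SO8" "T2 \<in> SO8"
    using assms unfolding Spin7_def by blast
  have lin: "Vector_Spaces.linear (*s) (*s) T1" "Vector_Spaces.linear (*s) (*s) T2"
    and det: "det (matrix T1) = 1" "det (matrix T2) = 1"
    using T by (auto simp: SO8_def)
  let ?M = "octo_block 1 (matrix T2) ** octo_block 2 (matrix T1) ** octo_block 3 (matrix (K_conj T1))"
  show ?thesis
  proof (rule restrict_in_SL_J3)
    show "spin7_act T A \<in> J3" if "A \<in> J3" for A
      using that by (elim J3_E) (simp add: T spin7_act_hmat)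
    show "det ?M = 1"
      by (simp add: det_mul det_octo_block det det_K_conj[OF lin(1)])
    show "j3_coords (spin7_act T A) = ?M *v j3_coords A" if "A \<in> J3" for A
    proof -
      from that obtain l1 l2 l3 a b c where A: "A = hmat l1 l2 l3 a b c" by (rule J3_E)
      show ?thesis
        unfolding A T spin7_act_hmat matrix_vector_mul_assoc[symmetric]
        unfolding vec_eq_iff forall_j3_index forall_3
        by (simp add: octo_block_mult j3_coords_hmat matrix_works lin det_K_conj)
    qed
  qed
qed

section \<open>SL(3) acts with determinant one\<close>

lemma sl3_act_add: "sl3_act C (A + B) = sl3_act C A + sl3_act C B"
  by (simp add: vec_eq_iff sl3_act_def sum.distrib distrib_left)

lemma sl3_act_scale: "sl3_act C (j3_scale t A) = j3_scale t (sl3_act C A)"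
  by (simp add: vec_eq_iff sl3_act_def j3_scale_def sum_distrib_left mult_ac)

lemma sl3_act_in_J3:
  assumes "A \<in> J3"
  shows "sl3_act C A \<in> J3"
proof -
  have H: "A $ l $ k = octo_cnj (A $ k $ l)" for k l using assms J3_iff_hermitian by blast
  have "sl3_act C A $ j $ i = octo_cnj (sl3_act C A $ i $ j)" for i j
  proof -
    have "sl3_act C A $ j $ i = (\<Sum>l\<in>UNIV. \<Sum>k\<in>UNIV. (C $ k $ j * C $ l $ i) *s A $ k $ l)"
      unfolding sl3_act_def by (simp, rule sum.swap)
    also have "\<dots> = (\<Sum>l\<in>UNIV. \<Sum>k\<in>UNIV. (C $ l $ i * C $ k $ j) *s octo_cnj (A $ l $ k))"
      using H by (metis (no_types, lifting) mult.commute sum.cong)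
    also have "\<dots> = octo_cnj (sl3_act C A $ i $ j)"
      by (simp add: sl3_act_def vec_eq_iff octo_cnj_nth sum_negf)
    finally show ?thesis .
  qed
  thus ?thesis unfolding J3_iff_hermitian by blast
qed

lemma sum_rotate:
  "(\<Sum>k\<in>K. \<Sum>l\<in>L. \<Sum>p\<in>P. f k l p) = (\<Sum>p\<in>P. \<Sum>k\<in>K. \<Sum>l\<in>L. f k l p)"
proof -
  have "(\<Sum>k\<in>K. \<Sum>l\<in>L. \<Sum>p\<in>P. f k l p) = (\<Sum>k\<in>K. \<Sum>p\<in>P. \<Sum>l\<in>L. f k l p)"
    by (intro sum.cong refl sum.swap)
  also have "\<dots> = (\<Sum>p\<in>P. \<Sum>k\<in>K. \<Sum>l\<in>L. f k l p)" by (rule sum.swap)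
  finally show ?thesis .
qed

lemma sl3_act_mult: "sl3_act D (sl3_act C A) = sl3_act (C ** D) A"
proof -
  have "sl3_act D (sl3_act C A) $ i $ j $ m = sl3_act (C ** D) A $ i $ j $ m" for i j m
  proof -
    let ?f = "\<lambda>k l p q. D $ k $ i * D $ l $ j * (C $ p $ k * C $ q $ l * A $ p $ q $ m)"
    have "sl3_act D (sl3_act C A) $ i $ j $ m
        = (\<Sum>k\<in>UNIV. \<Sum>l\<in>UNIV. \<Sum>p\<in>UNIV. \<Sum>q\<in>UNIV. ?f k l p q)"
      by (simp add: sl3_act_def sum_distrib_left)
    also have "\<dots> = (\<Sum>p\<in>UNIV. \<Sum>k\<in>UNIV. \<Sum>l\<in>UNIV. \<Sum>q\<in>UNIV. ?f k l p q)"
      by (rule sum_rotate)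
    also have "\<dots> = (\<Sum>p\<in>UNIV. \<Sum>q\<in>UNIV. \<Sum>k\<in>UNIV. \<Sum>l\<in>UNIV. ?f k l p q)"
      by (intro sum.cong refl sum_rotate)
    also have "\<dots> = (\<Sum>p\<in>UNIV. \<Sum>q\<in>UNIV.
        (\<Sum>k\<in>UNIV. C $ p $ k * D $ k $ i) * (\<Sum>l\<in>UNIV. C $ q $ l * D $ l $ j) * A $ p $ q $ m)"
      unfolding sum_product sum_distrib_right by (simp add: sum_distrib_left mult_ac)
    also have "\<dots> = sl3_act (C ** D) A $ i $ j $ m"
      by (simp add: sl3_act_def matrix_matrix_mult_def)
    finally show ?thesis .
  qed
  thus ?thesis by (simp add: vec_eq_iff)
qed

text \<open>
  The matrix in coordinates of the action of \<open>C\<close>. The action is a right action, so products are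
  reversed.
\<close>

definition sl3_matrix :: "complex^3^3 \<Rightarrow> complex^j3_index^j3_index" where
  "sl3_matrix C = matrix (\<lambda>v. j3_coords (sl3_act C (j3_of_coords v)))"

lemma sl3_matrix_works:
  assumes "A \<in> J3"
  shows "sl3_matrix C *v j3_coords A = j3_coords (sl3_act C A)"
proof -
  have "Vector_Spaces.linear (*s) (*s) (\<lambda>v. j3_coords (sl3_act C (j3_of_coords v)))"
    by (simp add: Vector_Spaces.linear_iff vec.vector_space_axioms j3_of_coords_add j3_of_coords_scale sl3_act_add sl3_act_scale
        j3_coords_add j3_coords_scale)
  thus ?thesis using assms by (simp add: sl3_matrix_def matrix_works)
qed

lemma sl3_matrix_mult: "sl3_matrix (C ** D) = sl3_matrix D ** sl3_matrix C"
  unfolding matrix_eq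
proof
  fix v
  have "sl3_matrix (C ** D) *v j3_coords (j3_of_coords v)
      = (sl3_matrix D ** sl3_matrix C) *v j3_coords (j3_of_coords v)"
    unfolding matrix_vector_mul_assoc[symmetric]
    by (simp only: sl3_matrix_works sl3_act_in_J3 j3_of_coords_in_J3 sl3_act_mult)
  thus "sl3_matrix (C ** D) *v v = (sl3_matrix D ** sl3_matrix C) *v v" by simp
qed

lemma prod_3: "(\<Prod>i\<in>UNIV. f i) = f 1 * f 2 * (f (3 :: 3) :: 'a :: comm_monoid_mult)"
  unfolding UNIV_3 by (simp add: mult.assoc)

definition diag3 :: "(3 \<Rightarrow> complex) \<Rightarrow> complex^3^3" where
  "diag3 d = (\<chi> i j. if i = j then d i else 0)"

lemma det_diag3: "det (diag3 d) = d 1 * d 2 * d 3"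
  by (simp add: det_3 diag3_def)

lemma sl3_act_diag3: "sl3_act (diag3 d) A $ i $ j = (d i * d j) *s A $ i $ j"
  by (simp add: sl3_act_def diag3_def if_distrib[of "\<lambda>x. x * _"] if_distrib[of "\<lambda>x. _ * x"]
      if_distrib[of "\<lambda>x. x *s _"] cong: if_cong)

text \<open>
  A diagonal matrix scales \<open>\<lambda>\<^sub>i\<close> by \<open>d\<^sub>i\<^sup>2\<close> and the eight coordinates of the entry \<open>(i, i + 1)\<close> by
  \<open>d\<^sub>i d\<^sub>i\<^sub>+\<^sub>1\<close>. In the product of all 27 weights each \<open>d\<^sub>i\<close> occurs \<open>2 + 2 * 8 = 18\<close> times.
\<close>

lemma det_sl3_matrix_diag3: "det (sl3_matrix (diag3 d)) = det (diag3 d) ^ 18"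
proof -
  define w :: "j3_index \<Rightarrow> complex" where
    "w = (\<lambda>k. case k of Inl i \<Rightarrow> d i * d i | Inr (i, m) \<Rightarrow> d i * d (i + 1))"
  let ?W = "(\<chi> k l. if k = l then w k else 0) :: complex^j3_index^j3_index"
  have "sl3_matrix (diag3 d) = ?W"
    unfolding matrix_eq
  proof
    fix v :: "complex^j3_index"
    define A where "A = j3_of_coords v"
    have v: "v = j3_coords A" "A \<in> J3" by (simp_all add: A_def)
    have "j3_coords (sl3_act (diag3 d) A) $ k = w k * j3_coords A $ k" for k
      by (cases k) (auto simp: j3_coords_def sl3_act_diag3 w_def split: prod.splits)
    also have "w k * j3_coords A $ k = (?W *v j3_coords A) $ k" for k
      by (simp add: matrix_vector_mult_def if_distrib[of "\<lambda>x. x * _"] cong: if_cong)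
    finally have "j3_coords (sl3_act (diag3 d) A) = ?W *v j3_coords A" by (simp add: vec_eq_iff)
    thus "sl3_matrix (diag3 d) *v v = ?W *v v" using v by (simp add: sl3_matrix_works)
  qed
  hence "det (sl3_matrix (diag3 d)) = (\<Prod>k\<in>UNIV. ?W $ k $ k)"
    by (simp only:) (rule det_diagonal, simp)
  also have "\<dots> = (\<Prod>k\<in>UNIV. w k)" by simp
  also have "\<dots> = (\<Prod>i\<in>UNIV. d i * d i) * (\<Prod>i\<in>UNIV. (d i * d (i + 1)) ^ 8)"
    unfolding prod_j3_index by (simp add: w_def)
  also have "\<dots> = (d 1 * d 1 * (d 1 ^ 8 * d 1 ^ 8)) * (d 2 * d 2 * (d 2 ^ 8 * d 2 ^ 8)) * (d 3 * d 3 * (d 3 ^ 8 * d 3 ^ 8))"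
    unfolding prod_3 succ_3 by (simp only: power_mult_distrib mult_ac)
  also have "\<dots> = det (diag3 d) ^ 18"
  proof -
    have "x * x * (x ^ 8 * x ^ 8) = x ^ 18" for x :: complex
      by (simp only: power2_eq_square[symmetric] power_add[symmetric]) simp
    thus ?thesis by (simp only: det_diag3 power_mult_distrib)
  qed
  finally show ?thesis .
qed

definition transvection :: "3 \<Rightarrow> 3 \<Rightarrow> complex \<Rightarrow> complex^3^3" where
  "transvection i j s = (\<chi> k l. (if k = l then 1 else 0) + (if k = i \<and> l = j then s else 0))"

lemma det_transvection: "i \<noteq> j \<Longrightarrow> det (transvection i j s) = 1"
  using exhaust_3[of i] exhaust_3[of j] by (auto simp: det_3 transvection_def)

lemma transvection_mult_nth:
  "(transvection i j s ** C) $ k $ l = C $ k $ l + (if k = i then s * C $ j $ l else 0)"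
proof -
  have "(transvection i j s ** C) $ k $ l
      = (\<Sum>m\<in>UNIV. (if m = k then C $ m $ l else 0)) + (\<Sum>m\<in>UNIV. if m = j then (if k = i then s * C $ m $ l else 0) else 0)"
    unfolding sum.distrib[symmetric] matrix_matrix_mult_def transvection_def
    by (simp, intro sum.cong refl) (auto simp: distrib_right)
  thus ?thesis by simp
qed

lemma diag3_mult_nth:
  "(diag3 d ** C) $ k $ l = d k * C $ k $ l" "(C ** diag3 d) $ k $ l = C $ k $ l * d l"
  by (simp_all add: matrix_matrix_mult_def diag3_def if_distrib[of "\<lambda>x. x * _"]
      if_distrib[of "\<lambda>x. _ * x"] cong: if_cong)

lemma transvection_relations:
  assumes "i \<noteq> j"
  shows "transvection i j s ** transvection i j r = transvection i j (s + r)"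
    and "diag3 (\<lambda>k. if k = i then 2 else 1) ** transvection i j s
      = transvection i j (2 * s) ** diag3 (\<lambda>k. if k = i then 2 else 1)"
proof -
  show "transvection i j s ** transvection i j r = transvection i j (s + r)"
    unfolding vec_eq_iff transvection_mult_nth using assms by (simp add: transvection_def)
  show "diag3 (\<lambda>k. if k = i then 2 else 1) ** transvection i j s
      = transvection i j (2 * s) ** diag3 (\<lambda>k. if k = i then 2 else 1)"
    unfolding vec_eq_iff diag3_mult_nth using assms by (auto simp: transvection_def)
qed

lemma det_sl3_matrix_mult: "det (sl3_matrix (C ** D)) = det (sl3_matrix C) * det (sl3_matrix D)"
  by (simp add: sl3_matrix_mult det_mul)

text \<open>
  Conjugation by a diagonal matrix turns the transvection with parameter \<open>s\<close> into the one with
  parameter \<open>2 s\<close>, which is its square. The determinant is nonzero and equal to its square.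
\<close>

lemma det_sl3_matrix_transvection:
  assumes "i \<noteq> j"
  shows "det (sl3_matrix (transvection i j s)) = 1"
proof -
  let ?\<chi> = "\<lambda>C. det (sl3_matrix C)"
  let ?T = "transvection i j s" and ?D = "diag3 (\<lambda>k. if k = i then 2 else 1 :: complex)"
  have "det ?D \<noteq> 0" by (simp add: det_diag3)
  hence D: "?\<chi> ?D \<noteq> 0" by (simp add: det_sl3_matrix_diag3)
  have square: "?\<chi> (transvection i j (2 * s)) = ?\<chi> ?T * ?\<chi> ?T"
    unfolding det_sl3_matrix_mult[symmetric] transvection_relations(1)[OF assms] by simp
  have "?\<chi> ?D * ?\<chi> ?T = ?\<chi> (transvection i j (2 * s)) * ?\<chi> ?D"
    unfolding det_sl3_matrix_mult[symmetric] transvection_relations(2)[OF assms] ..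
  hence 1: "?\<chi> ?T = ?\<chi> ?T * ?\<chi> ?T" using D unfolding square by simp
  have "?T ** transvection i j (- s) = diag3 (\<lambda>_. 1)"
    unfolding transvection_relations(1)[OF assms] by (simp add: transvection_def diag3_def vec_eq_iff)
  hence "?\<chi> ?T * ?\<chi> (transvection i j (- s)) = 1"
    unfolding det_sl3_matrix_mult[symmetric] by (simp add: det_sl3_matrix_diag3 det_diag3)
  hence "?\<chi> ?T \<noteq> 0" by auto
  thus ?thesis using 1 by simp
qed

lemma det_transvection_mult: "i \<noteq> j \<Longrightarrow> det (transvection i j s ** C) = det C"
  by (simp add: det_mul det_transvection)

text \<open>
  The class of matrices with this property is closed under products and under undoing row operations,
  so Gaussian elimination shows that it contains all invertible matrices.
\<close>

definition sl3_det_formula :: "complex^3^3 \<Rightarrow> bool" where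
  "sl3_det_formula C \<longleftrightarrow> det (sl3_matrix C) = det C ^ 18"

lemma sl3_det_formula_mult:
  "sl3_det_formula C \<Longrightarrow> sl3_det_formula D \<Longrightarrow> sl3_det_formula (C ** D)"
  by (simp add: sl3_det_formula_def sl3_matrix_mult det_mul power_mult_distrib)

lemma sl3_det_formula_row_operation:
  assumes "i \<noteq> j" "sl3_det_formula (transvection i j s ** C)"
  shows "sl3_det_formula C"
  using assms
  by (simp add: sl3_det_formula_def sl3_matrix_mult det_mul det_transvection det_sl3_matrix_transvection)

text \<open>
  With the transvections in this order no products of off-diagonal parameters appear, so these
  parameters can be read off from the entries.
\<close>

lemma sl3_det_formula_upper_triangular:
  assumes low: "U $ 2 $ 1 = 0" "U $ 3 $ 1 = 0" "U $ 3 $ 2 = 0"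
    and diag: "U $ 2 $ 2 \<noteq> 0" "U $ 3 $ 3 \<noteq> 0"
  shows "sl3_det_formula U"
proof -
  have "U = transvection 2 3 (U $ 2 $ 3 / U $ 3 $ 3) ** (transvection 1 3 (U $ 1 $ 3 / U $ 3 $ 3) **
      (transvection 1 2 (U $ 1 $ 2 / U $ 2 $ 2) ** diag3 (\<lambda>i. U $ i $ i)))"
    using assms by (simp add: vec_eq_iff forall_3 transvection_mult_nth diag3_def)
  moreover have T: "sl3_det_formula (transvection i j s)" if "i \<noteq> j" for i j s
    using that by (simp add: sl3_det_formula_def det_sl3_matrix_transvection det_transvection)
  have "sl3_det_formula (transvection 2 3 (U $ 2 $ 3 / U $ 3 $ 3) ** (transvection 1 3 (U $ 1 $ 3 / U $ 3 $ 3) **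
      (transvection 1 2 (U $ 1 $ 2 / U $ 2 $ 2) ** diag3 (\<lambda>i. U $ i $ i))))"
    by (intro sl3_det_formula_mult T) (simp_all add: sl3_det_formula_def det_sl3_matrix_diag3)
  ultimately show ?thesis by simp
qed

lemma sl3_det_formula_first_column:
  assumes C: "C $ 2 $ 1 = 0" "C $ 3 $ 1 = 0" and det: "det C \<noteq> 0"
  shows "sl3_det_formula C"
proof -
  have piv: "sl3_det_formula D" if D: "D $ 2 $ 1 = 0" "D $ 3 $ 1 = 0" "D $ 2 $ 2 \<noteq> 0" "det D \<noteq> 0" for D
  proof (rule sl3_det_formula_row_operation[of 3 2 "- D $ 3 $ 2 / D $ 2 $ 2"])
    let ?E = "transvection 3 2 (- D $ 3 $ 2 / D $ 2 $ 2) ** D"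
    have E: "?E $ 2 $ 1 = 0" "?E $ 3 $ 1 = 0" "?E $ 3 $ 2 = 0" "?E $ 2 $ 2 \<noteq> 0"
      using D by (simp_all add: transvection_mult_nth)
    have "det ?E \<noteq> 0" using D by (simp add: det_transvection_mult)
    hence "?E $ 3 $ 3 \<noteq> 0" using E by (auto simp: det_3)
    thus "sl3_det_formula ?E" using E by (intro sl3_det_formula_upper_triangular)
  qed simp
  show ?thesis
  proof (cases "C $ 2 $ 2 = 0")
    case True
    hence "C $ 3 $ 2 \<noteq> 0" using C det by (auto simp: det_3)
    \<comment> \<open>A vanishing pivot is replaced by adding a row whose entry in that column is nonzero.\<close>
    hence "sl3_det_formula (transvection 2 3 1 ** C)"
      using C det True by (intro piv) (simp_all add: transvection_mult_nth det_transvection_mult)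
    thus ?thesis by (rule sl3_det_formula_row_operation[rotated]) simp
  qed (use piv C det in blast)
qed

lemma det_sl3_matrix:
  assumes "det C \<noteq> 0"
  shows "det (sl3_matrix C) = det C ^ 18"
proof -
  have piv: "sl3_det_formula D" if D: "D $ 1 $ 1 \<noteq> 0" "det D \<noteq> 0" for D
  proof -
    let ?E = "transvection 3 1 (- D $ 3 $ 1 / D $ 1 $ 1) ** (transvection 2 1 (- D $ 2 $ 1 / D $ 1 $ 1) ** D)"
    have "sl3_det_formula ?E"
      using D by (intro sl3_det_formula_first_column) (simp_all add: transvection_mult_nth det_transvection_mult)
    hence "sl3_det_formula (transvection 2 1 (- D $ 2 $ 1 / D $ 1 $ 1) ** D)"
      by (rule sl3_det_formula_row_operation[rotated]) simp
    thus ?thesis by (rule sl3_det_formula_row_operation[rotated]) simp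
  qed
  have column: "C $ 1 $ 1 \<noteq> 0 \<or> C $ 2 $ 1 \<noteq> 0 \<or> C $ 3 $ 1 \<noteq> 0" using assms by (auto simp: det_3)
  have "sl3_det_formula C"
  proof (cases "C $ 1 $ 1 = 0")
    case True
    hence "C $ 2 $ 1 \<noteq> 0 \<or> C $ 3 $ 1 \<noteq> 0" using column by simp
    hence "\<exists>i. i \<noteq> 1 \<and> C $ i $ 1 \<noteq> 0" by (auto intro: exI[of _ 2] exI[of _ 3])
    then obtain i where i: "i \<noteq> 1" "C $ i $ 1 \<noteq> 0" by blast
    have "sl3_det_formula (transvection 1 i 1 ** C)"
      using True i assms by (intro piv) (simp_all add: transvection_mult_nth det_transvection_mult)
    thus ?thesis by (rule sl3_det_formula_row_operation[rotated]) (use i in simp)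
  qed (use piv assms in blast)
  thus ?thesis by (simp add: sl3_det_formula_def)
qed

lemma sl3_act_in_SL_J3:
  assumes "C \<in> SL3"
  shows "(\<lambda>A\<in>J3. sl3_act C A) \<in> carrier SL_J3"
proof (rule restrict_in_SL_J3)
  show "det (sl3_matrix C) = 1" using assms by (simp add: SL3_def det_sl3_matrix)
qed (simp_all add: sl3_act_in_J3 sl3_matrix_works)

section \<open>Moving inside an orbit\<close>

text \<open>
  Since the group acts, this is an equivalence relation on \<^term>\<open>J3\<close>, and moves can be chained.
\<close>

definition G_moves :: "octo^3^3 \<Rightarrow> octo^3^3 \<Rightarrow> bool" where
  "G_moves A B \<longleftrightarrow> A \<in> J3 \<and> B \<in> orbit (Cstar \<times>\<times> G_J3) scaling_act A"

lemma G_moves_iff: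
  "G_moves A B \<longleftrightarrow> A \<in> J3 \<and> (\<exists>t g. t \<noteq> 0 \<and> g \<in> carrier G_J3 \<and> B = j3_scale t (g A))"
  unfolding G_moves_def orbit_def by (auto simp: scaling_act_def Cstar_def)

abbreviation "G_generators \<equiv>
  {\<lambda>A\<in>J3. spin7_act T A | T. T \<in> Spin7} \<union> {\<lambda>A\<in>J3. sl3_act C A | C. C \<in> SL3}"

lemma G_generators_subset: "G_generators \<subseteq> carrier SL_J3"
  using spin7_act_in_SL_J3 sl3_act_in_SL_J3 by auto

lemma carrier_G_J3: "carrier G_J3 = generate SL_J3 G_generators"
  by (simp add: G_J3_def)

text \<open>
  Membership of the generators matters here: the inverse in \<^term>\<open>SL_J3\<close> of a map outside its carrier
  would be an unspecified value.
\<close>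

lemma G_J3_in_SL_J3: "g \<in> carrier G_J3 \<Longrightarrow> g \<in> carrier SL_J3"
  unfolding carrier_G_J3 using group.generate_in_carrier[OF group_SL_J3 G_generators_subset] .

lemma SL_J3_mult_one:
  "g \<in> carrier SL_J3 \<Longrightarrow> h \<in> carrier SL_J3 \<Longrightarrow> A \<in> J3 \<Longrightarrow> (g \<otimes>\<^bsub>SL_J3\<^esub> h) A = g (h A)"
  "A \<in> J3 \<Longrightarrow> \<one>\<^bsub>SL_J3\<^esub> A = A"
  by (auto simp: SL_J3_def BijGroup_def compose_def)

lemma SL_J3_linear:
  assumes "g \<in> carrier SL_J3"
  obtains M :: "complex^j3_index^j3_index"
  where "\<And>A. A \<in> J3 \<Longrightarrow> g A \<in> J3" "\<And>A. A \<in> J3 \<Longrightarrow> j3_coords (g A) = M *v j3_coords A"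
  using assms unfolding SL_J3_def by (auto simp: Bij_def bij_betw_def)

lemma j3_scale_in_J3: "A \<in> J3 \<Longrightarrow> j3_scale t A \<in> J3"
  by (elim J3_E) (simp add: j3_scale_hmat)

lemma j3_scale_scale: "j3_scale s (j3_scale t A) = j3_scale (s * t) A"
  by (simp add: j3_scale_def vec_eq_iff)

lemma j3_scale_1: "j3_scale 1 A = A"
  by (simp add: j3_scale_def vec_eq_iff)

lemma SL_J3_scale:
  assumes g: "g \<in> carrier SL_J3" and A: "A \<in> J3"
  shows "g (j3_scale t A) = j3_scale t (g A)"
proof -
  obtain M where M: "\<And>A. A \<in> J3 \<Longrightarrow> g A \<in> J3" "\<And>A. A \<in> J3 \<Longrightarrow> j3_coords (g A) = M *v j3_coords A"
    using SL_J3_linear[OF g] by blast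
  show ?thesis
    by (rule j3_coords_inject) (simp_all add: M A j3_scale_in_J3 j3_coords_scale vec.scale)
qed

lemma G_moves_in_J3: "G_moves A B \<Longrightarrow> A \<in> J3 \<and> B \<in> J3"
  unfolding G_moves_iff by (metis G_J3_in_SL_J3 SL_J3_linear j3_scale_in_J3)

lemma G_moves_trans [trans]:
  assumes "G_moves A B" "G_moves B C"
  shows "G_moves A C"
proof -
  obtain s g t h where *: "A \<in> J3" "s \<noteq> 0" "g \<in> carrier G_J3" "B = j3_scale s (g A)"
    "t \<noteq> 0" "h \<in> carrier G_J3" "C = j3_scale t (h B)"
    using assms unfolding G_moves_iff by blast
  have gJ: "g A \<in> J3" using *(1,3) by (metis G_J3_in_SL_J3 SL_J3_linear)
  have "C = j3_scale (t * s) ((h \<otimes>\<^bsub>SL_J3\<^esub> g) A)"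
    using * gJ by (simp add: SL_J3_mult_one SL_J3_scale G_J3_in_SL_J3 j3_scale_scale)
  moreover have "h \<otimes>\<^bsub>SL_J3\<^esub> g \<in> carrier G_J3"
    using *(3,6) unfolding carrier_G_J3 by (rule generate.eng[rotated])
  ultimately show ?thesis using * unfolding G_moves_iff by (metis mult_eq_0_iff)
qed

lemma G_moves_sym:
  assumes "G_moves A B"
  shows "G_moves B A"
proof -
  interpret S: group SL_J3 by (rule group_SL_J3)
  obtain s g where *: "A \<in> J3" "s \<noteq> 0" "g \<in> carrier G_J3" "B = j3_scale s (g A)"
    using assms unfolding G_moves_iff by blast
  let ?h = "inv\<^bsub>SL_J3\<^esub> g"
  have g: "g \<in> carrier SL_J3" and gJ: "g A \<in> J3"
    using *(1,3) G_J3_in_SL_J3 SL_J3_linear by metis+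
  have "?h (g A) = A"
    using SL_J3_mult_one(1)[of ?h g A] SL_J3_mult_one(2)[of A] g *(1) by simp
  hence "A = j3_scale (inverse s) (?h B)"
    using * g gJ by (simp add: SL_J3_scale j3_scale_scale j3_scale_1)
  moreover have "?h \<in> carrier G_J3"
    using *(3) S.generate_m_inv_closed[OF G_generators_subset] unfolding carrier_G_J3 by blast
  ultimately show ?thesis
    using * G_moves_in_J3[OF assms] unfolding G_moves_iff by (metis inverse_nonzero_iff_nonzero)
qed

lemma G_moves_generator:
  assumes "A \<in> J3" "(\<lambda>A\<in>J3. f A) \<in> G_generators"
  shows "G_moves A (f A)"
  unfolding G_moves_iff carrier_G_J3
  using assms by (intro conjI exI[of _ 1] exI[of _ "\<lambda>A\<in>J3. f A"] generate.incl) (simp_all add: j3_scale_1)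

lemma G_moves_Spin7:
  assumes "(T1, T2, T1) \<in> Spin7"
  shows "G_moves (hmat l1 l2 l3 a b c) (hmat l1 l2 l3 (T1 a) (K_conj T1 b) (T2 c))"
  unfolding spin7_act_hmat[symmetric] by (rule G_moves_generator) (simp, use assms in blast)

lemma G_moves_SL3: "C \<in> SL3 \<Longrightarrow> A \<in> J3 \<Longrightarrow> G_moves A (sl3_act C A)"
  by (rule G_moves_generator) auto

lemma G_moves_scale:
  assumes "A \<in> J3" "t \<noteq> 0"
  shows "G_moves A (j3_scale t A)"
  unfolding G_moves_iff carrier_G_J3
  using assms by (intro conjI exI[of _ t] exI[of _ "\<one>\<^bsub>SL_J3\<^esub>"] generate.one) (simp_all add: SL_J3_mult_one)

section \<open>Elimination\<close>

lemma G_moves_transvection: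
  "G_moves (hmat l1 l2 l3 a b c)
     (hmat (l1 + 2 * s * b $ 0 + s\<^sup>2 * l3) l2 l3 a (b + octo_of_complex (s * l3)) (c + s *s octo_cnj a))"
proof -
  have "sl3_act (transvection 3 1 s) (hmat l1 l2 l3 a b c)
    = hmat (l1 + 2 * s * b $ 0 + s\<^sup>2 * l3) l2 l3 a (b + octo_of_complex (s * l3)) (c + s *s octo_cnj a)"
    unfolding vec_eq_iff[where 'b = 3] forall_3
    by (simp add: sl3_act_def sum_3 transvection_def hmat_nth)
      (simp add: vec_eq_iff octo_of_complex_nth octo_cnj_nth power2_eq_square algebra_simps)
  moreover have "transvection 3 1 s \<in> SL3" by (simp add: SL3_def det_transvection)
  ultimately show ?thesis using G_moves_SL3[OF _ hmat_in_J3] by metis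
qed

lemma G_moves_cyclic: "G_moves (hmat l1 l2 l3 a b c) (hmat l2 l3 l1 b c a)"
proof -
  let ?C = "(\<chi> k i. if k = i + 1 then 1 else 0) :: complex^3^3"
  have "sl3_act ?C (hmat l1 l2 l3 a b c) = hmat l2 l3 l1 b c a"
    unfolding vec_eq_iff[where 'b = 3] forall_3
    by (simp add: sl3_act_def sum_3 hmat_nth)
  moreover have "?C \<in> SL3" by (simp add: SL3_def det_3)
  ultimately show ?thesis using G_moves_SL3[OF _ hmat_in_J3] by metis
qed

text \<open>
  The transposition of the first two indices has determinant \<open>- 1\<close>; its negative has determinant 1
  and acts in the same way, because the action is quadratic.
\<close>

lemma G_moves_swap:
  "G_moves (hmat l1 l2 l3 a b c) (hmat l2 l1 l3 (octo_cnj b) (octo_cnj a) (octo_cnj c))"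
proof -
  let ?C = "vector [vector [0, -1, 0], vector [-1, 0, 0], vector [0, 0, -1]] :: complex^3^3"
  have "sl3_act ?C (hmat l1 l2 l3 a b c) = hmat l2 l1 l3 (octo_cnj b) (octo_cnj a) (octo_cnj c)"
    unfolding vec_eq_iff[where 'b = 3] forall_3
    by (simp add: sl3_act_def sum_3 hmat_nth)
  moreover have "?C \<in> SL3" by (simp add: SL3_def det_3)
  ultimately show ?thesis using G_moves_SL3[OF _ hmat_in_J3] by metis
qed

text \<open>
  The elimination step with pivot \<open>l3\<close>: rotate the entry \<open>b\<close> to a scalar \<open>t\<close> with \<open>t\<^sup>2 = |b|\<^sup>2\<close>, then
  remove it. The new entry is \<open>c' = T\<^sub>2(c) - (t / l3) T\<^sub>1(a)\<^sup>*\<close>, where the star is conjugation, and the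
  relation \<open>T\<^sub>1(a) T\<^sub>2(c) = T\<^sub>1(a c)\<close> expresses its square norm without \<open>T\<^sub>1\<close> and \<open>T\<^sub>2\<close>. The last clause, on
  vanishing entries, ensures that later steps do not spoil zeros already obtained.
\<close>

lemma G_moves_eliminate:
  assumes l3: "l3 \<noteq> 0" and b: "octo_normsq b \<noteq> 0"
  shows "\<exists>a' c'. G_moves (hmat l1 l2 l3 a b c) (hmat (l1 - octo_normsq b / l3) l2 l3 a' 0 c')
    \<and> octo_normsq a' = octo_normsq a
    \<and> l3\<^sup>2 * octo_normsq c'
      = l3\<^sup>2 * octo_normsq c + octo_normsq a * octo_normsq b - 2 * l3 * (b \<odot> (a \<odot> c)) $ 0
    \<and> (a = 0 \<longrightarrow> a' = 0 \<and> (c = 0 \<longrightarrow> c' = 0))"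
proof -
  define t where "t = csqrt (octo_normsq b)"
  have t: "octo_normsq b = t\<^sup>2" "t \<noteq> 0" using b by (auto simp: t_def)
  obtain T1 T2 where T: "(T1, T2, T1) \<in> Spin7" and T1b: "T1 (octo_cnj b) = octo_of_complex t"
    using Spin7_to_scalar[of "octo_cnj b" t] t by auto
  have lin: "Vector_Spaces.linear (*s) (*s) T1" "Vector_Spaces.linear (*s) (*s) T2"
    and iso: "\<And>x. octo_normsq (T1 x) = octo_normsq x" "\<And>x. octo_normsq (T2 x) = octo_normsq x"
    and hom: "\<And>x y. T1 x \<odot> T2 y = T1 (x \<odot> y)"
    using T by (auto simp: Spin7_def SO8_def)
  define s where "s = - t / l3"
  have s: "s * l3 = - t" using l3 by (simp add: s_def)
  let ?c' = "T2 c + s *s octo_cnj (T1 a)"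
  have t0: "octo_of_complex t + octo_of_complex (- t) = 0"
    by (simp add: vec_eq_iff octo_of_complex_nth)
  have "K_conj T1 b = octo_of_complex t" by (simp add: K_conj_def T1b)
  hence "G_moves (hmat l1 l2 l3 a b c) (hmat l1 l2 l3 (T1 a) (octo_of_complex t) (T2 c))"
    using G_moves_Spin7[OF T, of l1 l2 l3 a b c] by simp
  also have "G_moves (hmat l1 l2 l3 (T1 a) (octo_of_complex t) (T2 c)) (hmat (l1 + 2 * s * t + s\<^sup>2 * l3) l2 l3 (T1 a) 0 ?c')"
    using G_moves_transvection[of l1 l2 l3 "T1 a" "octo_of_complex t" "T2 c" s]
    by (simp add: s octo_of_complex_nth t0)
  also have "l1 + 2 * s * t + s\<^sup>2 * l3 = l1 - octo_normsq b / l3"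
    using l3 by (simp add: s_def t(1) field_simps power2_eq_square)
  finally have moves: "G_moves (hmat l1 l2 l3 a b c) (hmat (l1 - octo_normsq b / l3) l2 l3 (T1 a) 0 ?c')" .
  have "t * octo_inner (T2 c) (octo_cnj (T1 a)) = t * (T1 (a \<odot> c)) $ 0"
    by (simp add: octo_inner_cnj_right hom)
  also have "\<dots> = octo_inner (T1 (a \<odot> c)) (T1 (octo_cnj b))"
    unfolding T1b by (simp add: octo_inner_expand octo_of_complex_nth)
  also have "\<dots> = (b \<odot> (a \<odot> c)) $ 0"
    unfolding octo_isometry_inner[OF lin(1) iso(1)] octo_inner_cnj_right ..
  finally have inner: "t * octo_inner (T2 c) (octo_cnj (T1 a)) = (b \<odot> (a \<odot> c)) $ 0" .
  have "octo_normsq ?c' = octo_normsq c + 2 * (s * octo_inner (T2 c) (octo_cnj (T1 a))) + s\<^sup>2 * octo_normsq a"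
    by (simp add: octo_normsq_add octo_normsq_scale iso octo_inner_def sum_distrib_left mult_ac)
  hence "l3\<^sup>2 * octo_normsq ?c' = l3\<^sup>2 * octo_normsq c
      + 2 * l3 * ((s * l3) * octo_inner (T2 c) (octo_cnj (T1 a))) + (s * l3)\<^sup>2 * octo_normsq a"
    by (simp add: power2_eq_square algebra_simps)
  also have "\<dots> = l3\<^sup>2 * octo_normsq c - 2 * l3 * (t * octo_inner (T2 c) (octo_cnj (T1 a)))
      + t\<^sup>2 * octo_normsq a"
    by (simp add: s)
  finally have "l3\<^sup>2 * octo_normsq ?c'
      = l3\<^sup>2 * octo_normsq c + octo_normsq a * octo_normsq b - 2 * l3 * (b \<odot> (a \<odot> c)) $ 0"
    by (simp add: inner t(1))
  moreover have "a = 0 \<longrightarrow> T1 a = 0 \<and> (c = 0 \<longrightarrow> ?c' = 0)"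
    by (auto simp: linear_octoD(3)[OF lin(1)] linear_octoD(3)[OF lin(2)] linear_octoD(3)[OF linear_octo_cnj])
  ultimately show ?thesis using moves iso(1) by blast
qed

text \<open>
  To reach \<open>r\<close> times the identity with determinant 1, \<open>r\<close> must be a cube root of \<open>d1 d2 d3\<close>. The
  square roots of \<open>r / d\<^sub>i\<close> have product \<open>\<sigma> = \<plusminus>1\<close>, and the sign is absorbed into the first of them.
\<close>

lemma G_moves_diagonal:
  assumes "d1 \<noteq> 0" "d2 \<noteq> 0" "d3 \<noteq> 0"
  shows "G_moves (hmat d1 d2 d3 0 0 0) (hmat 1 1 1 0 0 0)"
proof -
  define r where "r = exp (Ln (d1 * d2 * d3) / 3)"
  have "r ^ 3 = exp (Ln (d1 * d2 * d3))" unfolding r_def by (simp flip: exp_of_nat_mult)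
  hence r3: "r ^ 3 = d1 * d2 * d3" using assms by simp
  have r: "r \<noteq> 0" by (simp add: r_def)
  define e1 e2 e3 where "e1 = csqrt (r / d1)" and "e2 = csqrt (r / d2)" and "e3 = csqrt (r / d3)"
  have e: "e1\<^sup>2 * d1 = r" "e2\<^sup>2 * d2 = r" "e3\<^sup>2 * d3 = r"
    using assms by (simp_all add: e1_def e2_def e3_def)
  define \<sigma> where "\<sigma> = e1 * e2 * e3"
  have "\<sigma>\<^sup>2 * (d1 * d2 * d3) = (e1\<^sup>2 * d1) * (e2\<^sup>2 * d2) * (e3\<^sup>2 * d3)"
    unfolding \<sigma>_def by (simp add: power_mult_distrib)
  also have "\<dots> = d1 * d2 * d3" unfolding e r3[symmetric] by (simp add: power3_eq_cube)
  finally have \<sigma>: "\<sigma>\<^sup>2 = 1" using assms by simp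
  define d where "d = (\<lambda>i :: 3. if i = 1 then \<sigma> * e1 else if i = 2 then e2 else e3)"
  have "det (diag3 d) = \<sigma>\<^sup>2" by (simp add: det_diag3 d_def \<sigma>_def power2_eq_square)
  hence "diag3 d \<in> SL3" by (simp add: SL3_def \<sigma>)
  moreover have "d 1 * d 1 * d1 = r" "d 2 * d 2 * d2 = r" "d 3 * d 3 * d3 = r"
    using e \<sigma> by (simp_all add: d_def power2_eq_square mult_ac)
  hence "sl3_act (diag3 d) (hmat d1 d2 d3 0 0 0) = j3_scale r (hmat 1 1 1 0 0 0)"
    unfolding j3_scale_hmat vec_eq_iff[where 'b = 3] forall_3 sl3_act_diag3 hmat_nth
    by (simp add: vec_eq_iff octo_of_complex_nth octo_cnj_nth)
  ultimately have "G_moves (hmat d1 d2 d3 0 0 0) (j3_scale r (hmat 1 1 1 0 0 0))"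
    using G_moves_SL3[OF _ hmat_in_J3] by metis
  moreover have "G_moves (hmat 1 1 1 0 0 0) (j3_scale r (hmat 1 1 1 0 0 0))"
    using r by (intro G_moves_scale) simp_all
  ultimately show ?thesis using G_moves_sym G_moves_trans by blast
qed

text \<open>
  After the removal of \<open>b\<close> and then \<open>a\<close> with pivot \<open>l3\<close>, the remaining off-diagonal entry has square norm
  \<open>X / l3\<^sup>2\<close> and the other two diagonal entries are \<open>l1 - |b|\<^sup>2 / l3\<close> and \<open>l2 - |a|\<^sup>2 / l3\<close>. The last
  elimination uses the second of these as pivot. The hypotheses say that no pivot, no square norm of an entry
  to be removed and no final diagonal entry vanishes.
\<close>

lemma G_moves_generic:
  fixes l1 l2 l3 a b c
  defines "X \<equiv> l3\<^sup>2 * octo_normsq c + octo_normsq a * octo_normsq b - 2 * l3 * (b \<odot> (a \<odot> c)) $ 0"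
  assumes l3: "l3 \<noteq> 0" and a: "octo_normsq a \<noteq> 0" and b: "octo_normsq b \<noteq> 0" and X: "X \<noteq> 0"
    and l2: "l2 * l3 - octo_normsq a \<noteq> 0"
    and N: "(l1 * l3 - octo_normsq b) * (l2 * l3 - octo_normsq a) - X \<noteq> 0"
  shows "G_moves (hmat l1 l2 l3 a b c) (hmat 1 1 1 0 0 0)"
proof -
  define m1 m2 where "m1 = l1 - octo_normsq b / l3" and "m2 = l2 - octo_normsq a / l3"
  have m: "l3 * m1 = l1 * l3 - octo_normsq b" "l3 * m2 = l2 * l3 - octo_normsq a"
    using l3 by (simp_all add: m1_def m2_def field_simps)
  hence m2: "m2 \<noteq> 0" using l2 by auto
  obtain a' c' where 1: "G_moves (hmat l1 l2 l3 a b c) (hmat m1 l2 l3 a' 0 c')"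
    and a': "octo_normsq a' = octo_normsq a" and c': "l3\<^sup>2 * octo_normsq c' = X"
    using G_moves_eliminate[OF l3 b, of l1 l2 a c] unfolding m1_def X_def by blast
  note 1
  \<comment> \<open>The swap puts \<open>a\<close> in the place of \<open>b\<close>, keeping the pivot \<open>l3\<close>; the cyclic permutation below does
    the same for \<open>c\<close>, with \<open>m2\<close> as the pivot.\<close>
  also have "G_moves (hmat m1 l2 l3 a' 0 c') (hmat l2 m1 l3 0 (octo_cnj a') (octo_cnj c'))"
    using G_moves_swap[of m1 l2 l3 a' 0 c'] linear_octoD(3)[OF linear_octo_cnj] by simp
  also obtain c'' where "G_moves (hmat l2 m1 l3 0 (octo_cnj a') (octo_cnj c')) (hmat m2 m1 l3 0 0 c'')"
    and c'': "octo_normsq c'' = octo_normsq c'"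
  proof -
    have zero: "(octo_cnj a' \<odot> (0 \<odot> octo_cnj c')) $ 0 = 0" "octo_normsq 0 = 0"
      by (simp_all add: octo_mult_nth octo_normsq_eq)
    show thesis
      using G_moves_eliminate[OF l3, of "octo_cnj a'" l2 m1 0 "octo_cnj c'"] that a l3
      unfolding octo_normsq_cnj a' m2_def[symmetric] zero by auto
  qed
  note this(1)
  also have "G_moves (hmat m2 m1 l3 0 0 c'') (hmat m1 l3 m2 0 c'' 0)" by (rule G_moves_cyclic)
  also have "octo_normsq c'' \<noteq> 0" using X c' c'' by auto
  hence "G_moves (hmat m1 l3 m2 0 c'' 0) (hmat (m1 - octo_normsq c'' / m2) l3 m2 0 0 0)"
    using G_moves_eliminate[OF m2, of c'' m1 l3 0 0] by auto
  also have "m1 - octo_normsq c'' / m2 \<noteq> 0"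
  proof
    assume "m1 - octo_normsq c'' / m2 = 0"
    hence "m1 * m2 = octo_normsq c'" using m2 c'' by (simp add: field_simps)
    hence "(l3 * m1) * (l3 * m2) = l3\<^sup>2 * octo_normsq c'" by (simp add: power2_eq_square)
    thus False using N unfolding m c' by simp
  qed
  hence "G_moves (hmat (m1 - octo_normsq c'' / m2) l3 m2 0 0 0) (hmat 1 1 1 0 0 0)"
    using l3 m2 by (intro G_moves_diagonal)
  finally show ?thesis .
qed

section \<open>The open dense orbit\<close>

definition octo_coord :: "3 \<Rightarrow> complex^j3_index \<Rightarrow> octo" where
  "octo_coord i v = (\<chi> m. v $ Inr (i, m))"

lemma polynomial_fun_octo_coord: "polynomial_fun (\<lambda>v. octo_coord i v $ m)"
  unfolding octo_coord_def by (simp add: polynomial_fun.coord)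

lemma polynomial_fun_octo_mult:
  assumes "\<And>m. polynomial_fun (\<lambda>v. x v $ m)" "\<And>m. polynomial_fun (\<lambda>v. y v $ m)"
  shows "polynomial_fun (\<lambda>v. (x v \<odot> y v) $ m)"
proof -
  have "\<forall>m. polynomial_fun (\<lambda>v. (x v \<odot> y v) $ m)"
    unfolding forall_8 octo_mult_nth
    by (intro conjI polynomial_fun.add polynomial_fun_diff polynomial_fun.mult assms)
  thus ?thesis by blast
qed

lemma polynomial_fun_octo_normsq:
  assumes "\<And>m. polynomial_fun (\<lambda>v. x v $ m)"
  shows "polynomial_fun (\<lambda>v. octo_normsq (x v))"
  unfolding octo_normsq_eq by (intro polynomial_fun.add polynomial_fun_power assms)

text \<open>
  \<open>l3\<^sup>2\<close> times the square norm of the entry \<open>c\<close> after the entry \<open>b\<close> has been eliminated with pivot \<open>l3\<close>.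
\<close>

definition mixed_poly :: "complex^j3_index \<Rightarrow> complex" where
  "mixed_poly v = (let a = octo_coord 2 v; b = octo_coord 3 v; c = octo_coord 1 v; l3 = v $ Inl 3 in
     l3\<^sup>2 * octo_normsq c + octo_normsq a * octo_normsq b - 2 * l3 * (b \<odot> (a \<odot> c)) $ 0)"

text \<open>
  The product of the conditions under which the elimination reaches the identity.
\<close>

definition generic_poly :: "complex^j3_index \<Rightarrow> complex" where
  "generic_poly v = (let a = octo_coord 2 v; b = octo_coord 3 v; m = v $ Inl 2 * v $ Inl 3 - octo_normsq a in
     v $ Inl 3 * octo_normsq a * octo_normsq b * mixed_poly v * m
     * ((v $ Inl 1 * v $ Inl 3 - octo_normsq b) * m - mixed_poly v))"

lemma polynomial_fun_generic_poly: "polynomial_fun generic_poly"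
proof -
  have mixed: "polynomial_fun mixed_poly"
    unfolding mixed_poly_def[abs_def] Let_def
    by (intro polynomial_fun.add polynomial_fun_diff polynomial_fun.mult polynomial_fun_power
        polynomial_fun.const polynomial_fun.coord polynomial_fun_octo_normsq polynomial_fun_octo_mult
        polynomial_fun_octo_coord)
  show ?thesis
    unfolding generic_poly_def[abs_def] Let_def
    by (intro polynomial_fun_diff polynomial_fun.mult mixed
        polynomial_fun.coord polynomial_fun_octo_normsq polynomial_fun_octo_coord)
qed

lemma octo_coord_hmat:
  "octo_coord 1 (j3_coords (hmat l1 l2 l3 a b c)) = c"
  "octo_coord 2 (j3_coords (hmat l1 l2 l3 a b c)) = a"
  "octo_coord 3 (j3_coords (hmat l1 l2 l3 a b c)) = b"
  by (simp_all add: octo_coord_def j3_coords_hmat vec_eq_iff)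

lemma generic_poly_moves:
  assumes "A \<in> J3" "generic_poly (j3_coords A) \<noteq> 0"
  shows "G_moves A (hmat 1 1 1 0 0 0)"
proof -
  obtain l1 l2 l3 a b c where A: "A = hmat l1 l2 l3 a b c" using assms(1) by (rule J3_E)
  show ?thesis
    using assms(2) unfolding A generic_poly_def mixed_poly_def Let_def octo_coord_hmat j3_coords_hmat
      mult_eq_0_iff de_Morgan_disj
    by (elim conjE) (rule G_moves_generic)
qed

text \<open>
  At this matrix the pivots and norms are small integers: \<open>|a|\<^sup>2 = |b|\<^sup>2 = 1\<close>, the mixed term is
  \<open>4 + 1 - 4 = 1\<close>, and both \<open>2 * 2\<close> minors that occur are \<open>3 * 2 - 1 = 5\<close>, so the last factor is 24.
\<close>

lemma generic_poly_nonzero: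
  "generic_poly (j3_coords (hmat 3 3 2 (octo_of_complex 1) (octo_of_complex 1) (octo_of_complex 1))) \<noteq> 0"
proof -
  have "octo_normsq (octo_of_complex 1) = 1" by (simp add: octo_normsq_eq octo_of_complex_nth)
  thus ?thesis
    unfolding generic_poly_def mixed_poly_def Let_def octo_coord_hmat j3_coords_hmat octo_mult_one
    by (simp add: octo_of_complex_nth)
qed

theorem theorem3:
  shows "\<exists>A\<in>J3.
    openin zariski_J3 (orbit (Cstar \<times>\<times> G_J3) scaling_act A) \<and>
    zariski_J3 closure_of (orbit (Cstar \<times>\<times> G_J3) scaling_act A) = J3"
proof (rule bexI, rule conjI)
  let ?I = "hmat 1 1 1 0 0 0"
  let ?O = "orbit (Cstar \<times>\<times> G_J3) scaling_act ?I"
  show "?I \<in> J3" by simp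
  have O: "B \<in> ?O \<longleftrightarrow> G_moves ?I B" for B by (simp add: G_moves_def)
  have generic: "{A \<in> J3. generic_poly (j3_coords A) \<noteq> 0} \<subseteq> ?O"
    unfolding O subset_eq using generic_poly_moves G_moves_sym by blast
  show "zariski_J3 closure_of ?O = J3"
    by (rule zariski_J3_dense[OF polynomial_fun_generic_poly generic_poly_nonzero generic])
  \<comment> \<open>Some element \<open>(t, g)\<close> moves \<open>B\<close> into the generic set, here to the matrix \<open>?G\<close>; the preimage of the
    generic set under \<open>(t, g)\<close> is an open neighbourhood of \<open>B\<close> inside the orbit.\<close>
  let ?G = "hmat 3 3 2 (octo_of_complex 1) (octo_of_complex 1) (octo_of_complex 1)"
  have "\<exists>V. openin zariski_J3 V \<and> B \<in> V \<and> V \<subseteq> ?O" if B: "B \<in> ?O" for B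
  proof -
    have "G_moves B ?I" using B unfolding O by (rule G_moves_sym)
    moreover have "G_moves ?I ?G"
      using generic_poly_moves[OF hmat_in_J3 generic_poly_nonzero] by (rule G_moves_sym)
    ultimately have "G_moves B ?G" by (rule G_moves_trans)
    then obtain t g where g: "B \<in> J3" "t \<noteq> 0" "g \<in> carrier G_J3" "?G = j3_scale t (g B)"
      unfolding G_moves_iff by blast
    obtain M where M: "\<And>A. A \<in> J3 \<Longrightarrow> g A \<in> J3" "\<And>A. A \<in> J3 \<Longrightarrow> j3_coords (g A) = M *v j3_coords A"
      using SL_J3_linear[OF G_J3_in_SL_J3[OF g(3)]] by blast
    define q where "q v = generic_poly ((mat t ** M) *v v)" for v
    have q: "q (j3_coords A) = generic_poly (j3_coords (j3_scale t (g A)))" if "A \<in> J3" for A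
    proof -
      have "mat t *v v = t *s v" for v :: "complex^j3_index"
        by (simp add: matrix_vector_mult_def mat_def vec_eq_iff if_distrib[of "\<lambda>x. x * _"] cong: if_cong)
      thus ?thesis using that by (simp add: q_def M j3_coords_scale flip: matrix_vector_mul_assoc)
    qed
    let ?V = "{A \<in> J3. q (j3_coords A) \<noteq> 0}"
    have "openin zariski_J3 ?V"
      unfolding q_def by (intro openin_zariski_J3_nonzero polynomial_fun_linear_subst polynomial_fun_generic_poly)
    moreover have "B \<in> ?V" using g(1,4) q[OF g(1)] generic_poly_nonzero by simp
    moreover have "?V \<subseteq> ?O"
    proof
      fix A assume "A \<in> ?V"
      hence A: "A \<in> J3" "generic_poly (j3_coords (j3_scale t (g A))) \<noteq> 0" using q by auto
      have "G_moves A (j3_scale t (g A))" unfolding G_moves_iff using A g by blast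
      also have "G_moves \<dots> ?I" using A by (intro generic_poly_moves) (simp_all add: M j3_scale_in_J3)
      finally show "A \<in> ?O" unfolding O by (rule G_moves_sym)
    qed
    ultimately show ?thesis by blast
  qed
  thus "openin zariski_J3 ?O" by (subst openin_subopen) blast
qed

end
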